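(* Each first countable topological space is the image of a complete economical metric space under a continuous monotone hereditarily quotient map, and each connected first countable space is the image of a connected complete economical metric space under a continuous monotone hereditarily quotient map. Each weakly first countable topological space is the image of a complete economical metric space under a continuous monotone quotient map, and each connected weakly first countable space is the image of a connected complete economical metric space under a continuous monotone quotient map.
   Context: A metric $d$ on $X$ is economical if for every infinite subset $A\subset X$ one has $|\{d(a,b):a,b\in A\}|\le\mathrm{dens}(A)$, where $\mathrm{dens}(A)=\min\{|D|: D\subset A\subset\overline D\}$; a complete economical metric space is a metric space whose metric is both complete and economical. A topological space $X$ is weakly first countable if to each $x\in X$ one can assign a decreasing sequence $(B_n(x))_{n\in\omega}$ of subsets of $X$ containing $x$ such that a subset $U\subset X$ is open if and only if for each $x\in U$ there is $n\in\omega$ with $B_n(x)\subset U$. For topological spaces $X,Y$, a function $f\colon X\to Y$ is: monotone if $f^{-1}(y)$ is connected for each $y\in Y$; quotient if $A\subset Y$ is open in $Y$ whenever $f^{-1}(A)$ is open in $X$; hereditarily quotient if for every open $U\subset X$ and every $y\in Y$, $f^{-1}(y)\subset U$ implies $y\in\mathrm{Int}(f(U))$. "$X$ is the image of $Z$ under $f$" means $f\colon Z\to X$ is surjective. No separation axioms are assumed. *)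

theory Defs
  imports "HOL-Analysis.Analysis"
begin

unbundle cardinal_syntax

definition dense_subsets :: "'a topology \<Rightarrow> 'a set \<Rightarrow> 'a set set" where
  "dense_subsets X A = {D. D \<subseteq> A \<and> A \<subseteq> X closure_of D}"

text \<open>The density of \<open>A\<close> is a cardinal in the sense of the BNF cardinal library, i.e. a
  well-order of minimal length, unique up to \<open>=o\<close>. Minima with respect to \<open>\<le>o\<close> are not
  covered by \<open>LEAST\<close>, hence the choice operator; see the two lemmas below.\<close>

definition dens :: "'a topology \<Rightarrow> 'a set \<Rightarrow> 'a rel" where
  "dens X A = (SOME r. r \<in> card_of ` dense_subsets X A \<and> (\<forall>D\<in>dense_subsets X A. r \<le>o |D| ))"

lemma dens_spec:
  assumes "A \<subseteq> topspace X"
  shows "dens X A \<in> card_of ` dense_subsets X A \<and> (\<forall>D\<in>dense_subsets X A. dens X A \<le>o |D| )"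
  unfolding dens_def
proof (rule someI_ex)
  have "A \<in> dense_subsets X A"
    using closure_of_subset[OF assms] by (simp add: dense_subsets_def)
  then have "card_of ` dense_subsets X A \<noteq> {}" by blast
  moreover have "\<forall>r \<in> card_of ` dense_subsets X A. Well_order r"
    using card_of_Well_order by blast
  ultimately show "\<exists>r. r \<in> card_of ` dense_subsets X A \<and> (\<forall>D\<in>dense_subsets X A. r \<le>o |D| )"
    using exists_minim_Well_order[of "card_of ` dense_subsets X A"] by blast
qed

lemma ordLeq_dens_iff:
  assumes "A \<subseteq> topspace X"
  shows "|S| \<le>o dens X A \<longleftrightarrow> (\<forall>D\<in>dense_subsets X A. |S| \<le>o |D| )"
  using dens_spec[OF assms] ordLeq_transitive by fastforce

definition economical :: "'a set \<Rightarrow> ('a \<Rightarrow> 'a \<Rightarrow> real) \<Rightarrow> bool" where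
  "economical M d \<longleftrightarrow>
     (\<forall>A. A \<subseteq> M \<and> infinite A \<longrightarrow>
        |{d a b | a b. a \<in> A \<and> b \<in> A}| \<le>o dens (Metric_space.mtopology M d) A)"

definition complete_economical_metric_space :: "'a set \<Rightarrow> ('a \<Rightarrow> 'a \<Rightarrow> real) \<Rightarrow> bool" where
  "complete_economical_metric_space M d \<longleftrightarrow>
     Metric_space M d \<and> Metric_space.mcomplete M d \<and> economical M d"

definition weakly_first_countable :: "'a topology \<Rightarrow> bool" where
  "weakly_first_countable X \<longleftrightarrow>
     (\<exists>B :: 'a \<Rightarrow> nat \<Rightarrow> 'a set.
        (\<forall>x\<in>topspace X. decseq (B x) \<and> (\<forall>n. x \<in> B x n \<and> B x n \<subseteq> topspace X)) \<and>
        (\<forall>U. U \<subseteq> topspace X \<longrightarrow> (openin X U \<longleftrightarrow> (\<forall>x\<in>U. \<exists>n. B x n \<subseteq> U))))"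

definition hereditarily_quotient_map :: "'a topology \<Rightarrow> 'b topology \<Rightarrow> ('a \<Rightarrow> 'b) \<Rightarrow> bool" where
  "hereditarily_quotient_map X Y f \<longleftrightarrow>
     (\<forall>U y. openin X U \<and> y \<in> topspace Y \<and> {x \<in> topspace X. f x = y} \<subseteq> U
        \<longrightarrow> y \<in> Y interior_of (f ` U))"

text \<open>A formula cannot quantify existentially over types, so the points of the metric spaces
  that a statement asserts to exist are taken from the fixed type \<open>nat \<Rightarrow> 'a \<times> real\<close>, where \<open>'a\<close>
  is the type of the points of the given space. It has the cardinality of
  \<open>(|'a| * continuum) ^ aleph_0\<close>, the largest possible size of a metric space of density at
  most \<open>|'a| * continuum\<close>.\<close>

type_synonym 'a pt = "nat \<Rightarrow> 'a \<times> real"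

end

theory Submission
  imports Defs
begin

text \<open>Suppose that a complete metric space $K$ of diameter $1$ is connected and has two points, its
ends, at distance $1$. Given a weak base $B$ of $X$, take the points of $X$ as vertices, pairwise
at distance $1$, and for every $x$, every $n$ and every $y \neq x$ in $B_n(x)$ hang a copy of $K$
on the vertex $y$: its second end is the vertex $y$, and its first end lies at distance $2^{-n}$
from the vertex $x$. Let $f$ send the vertex $y$ and all the blocks hanging on it to $y$. Each
fibre of $f$ is a bouquet of copies of $K$ and therefore connected. A ball of radius
$2^{-n}$ around the vertex $y$ meets only blocks that hang on $y$ or that start at $y$
with a jump shorter than $2^{-n}$, and the latter hang on points of $B_n(y)$; so $f$ is
continuous. Conversely, every neighbourhood of the vertex $y$ contains, for some $n$, the first
ends of blocks hanging on all the other points of $B_n(y)$; so its image contains $B_n(y)$. This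
makes $f$ a quotient map, and a hereditarily quotient map if the sets $B_n(y)$ are
open. The preimage of a connected space under a monotone quotient map is connected.

The space $K$ comes from the same construction over the interval $[0,1]$, with a block for every
pair $s \neq t$ with $t \neq 1$, a jump of length $| s - t|$, and with copies of $K$ itself, reduced by the
factor $1/2$, as the blocks. Its points are thus finite or infinite words of edges, and its metric
is the fixed point of an operator that takes a metric on the blocks to a metric on
the whole. If a clopen set splits $K$, then it splits one of the blocks, since $[0,1]$ is
connected; this block is a copy of $K$, so the argument can be repeated, and it yields a nested
sequence of split blocks that shrink to a point of $K$, which is absurd.

A connected space of more than one point with few distances cannot be separable, and the metric
has to be chosen with care. Blocks are glued with maxima in place of sums of distances. As a consequence, the
distance of two points is of the form $2^{-j} | u - v|$, where $u$ and $v$ are $0$, $1$ or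
occur in one of the two words, even if both words are infinite. Each number that occurs in a word
also occurs in all the words sufficiently close to it. Hence all the distances between points of a
set come from numbers that occur in the points of any dense subset $D$, and if $D$ is infinite
there are at most $| D|$ of them.\<close>

section \<open>Gluing metric blocks along a weighted directed graph\<close>

text \<open>The combinatorics shared by both levels of the construction. A point is a vertex \<open>vx v\<close> or
a point \<open>mk s t w k\<close> of the block over an edge from \<open>s\<close> to \<open>t\<close> of weight \<open>w\<close>. Each block is
a copy of \<open>K\<close> without its second end \<open>b\<close>, whose place is taken by the vertex \<open>t\<close>; its first
end \<open>a\<close> is reached from the vertex \<open>s\<close> by a jump of length \<open>w\<close>.\<close>

locale web =
  fixes V :: "'v set" and edge :: "'v \<Rightarrow> 'v \<Rightarrow> real \<Rightarrow> bool"
    and K :: "'k set" and a b :: 'k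
    and vx :: "'v \<Rightarrow> 'p" and mk :: "'v \<Rightarrow> 'v \<Rightarrow> real \<Rightarrow> 'k \<Rightarrow> 'p"
    and src tgt :: "'p \<Rightarrow> 'v" and wt :: "'p \<Rightarrow> real" and body :: "'p \<Rightarrow> 'k"
  assumes edgeD: "edge s t w \<Longrightarrow> s \<in> V \<and> t \<in> V \<and> s \<noteq> t \<and> 0 < w \<and> w \<le> 1"
    and ends: "a \<in> K" "b \<in> K" "a \<noteq> b"
    and src_vx [simp]: "src (vx v) = v" and tgt_vx [simp]: "tgt (vx v) = v"
    and body_vx: "v \<in> V \<Longrightarrow> body (vx v) \<in> K"
    and src_mk [simp]: "src (mk s t w k) = s" and tgt_mk [simp]: "tgt (mk s t w k) = t"
    and wt_mk: "edge s t w \<Longrightarrow> wt (mk s t w k) = w"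
    and body_mk [simp]: "body (mk s t w k) = k"
begin

definition points :: "'p set" where
  "points = vx ` V \<union> {mk s t w k | s t w k. edge s t w \<and> k \<in> K \<and> k \<noteq> b}"

definition same :: "'p \<Rightarrow> 'p \<Rightarrow> bool" where
  "same p q \<longleftrightarrow> src p = src q \<and> tgt p = tgt q \<and> wt p = wt q"

text \<open>The distance from a point to a vertex, with \<open>1\<close> for all the vertices to which the point is not
attached. The jump enters by a maximum.\<close>

definition near :: "('k \<Rightarrow> 'k \<Rightarrow> real) \<Rightarrow> 'p \<Rightarrow> 'v \<Rightarrow> real" where
  "near d p v =
     (if src p = tgt p then (if v = tgt p then 0 else 1)
      else if v = src p then max (wt p) (d (body p) a)
      else if v = tgt p then d (body p) b
      else 1)"

text \<open>Points of different blocks are compared at a vertex to which both are close. Only the two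
vertices adjacent to \<open>p\<close> are inspected, because \<open>near d p\<close> has its largest value \<open>1\<close> at all others;
so the formula is symmetric in \<open>p\<close> and \<open>q\<close>.\<close>

definition glue :: "('k \<Rightarrow> 'k \<Rightarrow> real) \<Rightarrow> 'p \<Rightarrow> 'p \<Rightarrow> real" where
  "glue d p q =
     (if same p q then d (body p) (body q)
      else min (max (near d p (src p)) (near d q (src p)))
               (max (near d p (tgt p)) (near d q (tgt p))))"

text \<open>The whole of \<open>K\<close>, including its second end, as the closed block over an edge.\<close>

definition embed :: "'v \<Rightarrow> 'v \<Rightarrow> real \<Rightarrow> 'k \<Rightarrow> 'p" where
  "embed s t w k = (if k = b then vx t else mk s t w k)"

lemma points_cases [consumes 1, case_names vertex edge]:
  assumes "p \<in> points"
  obtains v where "v \<in> V" "p = vx v"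
  | s t w k where "edge s t w" "k \<in> K" "k \<noteq> b" "p = mk s t w k"
  using assms unfolding points_def by blast

lemma vx_in [simp]: "v \<in> V \<Longrightarrow> vx v \<in> points"
  by (auto simp: points_def)

lemma mk_in: "edge s t w \<Longrightarrow> k \<in> K \<Longrightarrow> k \<noteq> b \<Longrightarrow> mk s t w k \<in> points"
  by (auto simp: points_def)

lemma embed_in: "edge s t w \<Longrightarrow> k \<in> K \<Longrightarrow> embed s t w k \<in> points"
  using edgeD[of s t w] by (auto simp: embed_def mk_in)

lemma tgt_embed [simp]: "tgt (embed s t w k) = t"
  by (simp add: embed_def)

lemma body_in: "p \<in> points \<Longrightarrow> body p \<in> K"
  by (cases rule: points_cases) (auto simp: body_vx)

lemma src_in: "p \<in> points \<Longrightarrow> src p \<in> V"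
  by (cases rule: points_cases) (auto dest: edgeD)

lemma tgt_in: "p \<in> points \<Longrightarrow> tgt p \<in> V"
  by (cases rule: points_cases) (auto dest: edgeD)

lemma vertex_eq: "p \<in> points \<Longrightarrow> src p = tgt p \<Longrightarrow> p = vx (tgt p)"
  by (cases rule: points_cases) (auto dest: edgeD)

lemma edge_eq:
  assumes "p \<in> points" "src p \<noteq> tgt p"
  shows "edge (src p) (tgt p) (wt p)" "body p \<noteq> b" "p = mk (src p) (tgt p) (wt p) (body p)"
  using assms by (cases rule: points_cases; simp add: wt_mk)+

lemma same_refl [simp]: "same p p"
  and same_sym: "same p q \<Longrightarrow> same q p"
  and same_trans: "same p q \<Longrightarrow> same q r \<Longrightarrow> same p r"
  by (auto simp: same_def)

lemma same_eqI:
  assumes "p \<in> points" "q \<in> points" "same p q" "src p = tgt p \<or> body p = body q"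
  shows "p = q"
  using assms vertex_eq[of p] vertex_eq[of q] edge_eq(3)[of p] edge_eq(3)[of q]
  by (metis same_def)

lemma near_vx [simp]: "near d (vx u) v = (if v = u then 0 else 1)"
  by (simp add: near_def)

lemma near_mk:
  "edge s t w \<Longrightarrow> near d (mk s t w k) v =
     (if v = s then max w (d k a) else if v = t then d k b else 1)"
  using edgeD[of s t w] by (simp add: near_def wt_mk)

lemma near_other: "v \<noteq> src p \<Longrightarrow> v \<noteq> tgt p \<Longrightarrow> near d p v = 1"
  by (simp add: near_def)

end

text \<open>Nothing is asked outside of \<open>K\<close>, in contrast to \<open>Metric_space\<close>, whose conditions of symmetry and
nonnegativity concern the whole type and would not be preserved by gluing and limits.\<close>

definition unit_pmetric :: "'k set \<Rightarrow> ('k \<Rightarrow> 'k \<Rightarrow> real) \<Rightarrow> bool" where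
  "unit_pmetric K d \<longleftrightarrow>
     (\<forall>x\<in>K. d x x = 0) \<and>
     (\<forall>x\<in>K. \<forall>y\<in>K. 0 \<le> d x y \<and> d x y \<le> 1 \<and> d x y = d y x) \<and>
     (\<forall>x\<in>K. \<forall>y\<in>K. \<forall>z\<in>K. d x z \<le> d x y + d y z)"

lemma unit_pmetricD:
  assumes "unit_pmetric K d" "x \<in> K"
  shows "d x x = 0" "y \<in> K \<Longrightarrow> 0 \<le> d x y" "y \<in> K \<Longrightarrow> d x y \<le> 1"
    "y \<in> K \<Longrightarrow> d x y = d y x" "y \<in> K \<Longrightarrow> z \<in> K \<Longrightarrow> d x z \<le> d x y + d y z"
  using assms unfolding unit_pmetric_def by blast+

locale web_pmetric = web +
  fixes d :: "'b \<Rightarrow> 'b \<Rightarrow> real"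
  assumes pm: "unit_pmetric K d" and ends_dist: "d a b = 1"
begin

lemmas d_props = unit_pmetricD[OF pm]

lemma near_bounds:
  assumes "p \<in> points"
  shows "0 \<le> near d p v \<and> near d p v \<le> 1"
  using assms
proof (cases rule: points_cases)
  case (edge s t w k)
  then show ?thesis
    using ends edgeD[of s t w] by (auto simp: near_mk d_props)
qed auto

lemma near_ge0: "p \<in> points \<Longrightarrow> 0 \<le> near d p v"
  and near_le1: "p \<in> points \<Longrightarrow> near d p v \<le> 1"
  using near_bounds by blast+

text \<open>The two ends of a block have distance \<open>1\<close>, so no point is closer than \<open>1/2\<close> to two vertices.
This is what makes the maxima in \<open>glue\<close> satisfy the triangle inequality.\<close>

lemma near_sum:
  assumes "p \<in> points" "u \<noteq> v"
  shows "1 \<le> near d p u + near d p v"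
  using assms
proof (cases rule: points_cases)
  case (edge s t w k)
  have "1 \<le> d k a + d k b"
    using d_props(4,5)[of a k] d_props(5)[of a k b] ends ends_dist edge by auto
  moreover have "0 \<le> d k a" "0 \<le> d k b" "0 < w"
    using ends edge edgeD[of s t w] by (auto simp: d_props)
  ultimately show ?thesis
    using edge \<open>u \<noteq> v\<close> by (auto simp: near_mk)
qed auto

lemma near_unique:
  "p \<in> points \<Longrightarrow> near d p u < 1/2 \<Longrightarrow> near d p v < 1/2 \<Longrightarrow> u = v"
  using near_sum[of p u v] by fastforce

lemma near_less1: "near d p v < 1 \<Longrightarrow> v = src p \<or> v = tgt p"
  using near_other[of v p d] by fastforce

lemma same_near:
  assumes "p \<in> points" "q \<in> points" "same p q"
  shows "near d p v \<le> glue d p q + near d q v"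
    and "glue d p q \<le> near d p v + near d q v"
proof -
  have K: "body p \<in> K" "body q \<in> K" using assms by (auto simp: body_in)
  have g: "glue d p q = d (body p) (body q)" using assms by (simp add: glue_def)
  have eq: "src q = src p" "tgt q = tgt p" "wt q = wt p" using assms(3) by (auto simp: same_def)
  have "p = q" if "src p = tgt p" using same_eqI assms that by blast
  then have z: "d (body p) (body q) = 0" if "src p = tgt p" using that K by (auto simp: d_props)
  note t = d_props(5)[of "body p" "body q" a] d_props(5)[of "body p" "body q" b]
    d_props(5)[of "body p" a "body q"] d_props(5)[of "body p" b "body q"]
    d_props(4)[of a "body q"] d_props(4)[of b "body q"]
    d_props(2,3)[of "body p" "body q"]
  show "near d p v \<le> glue d p q + near d q v"
    unfolding g near_def eq using z K ends t by auto
  show "glue d p q \<le> near d p v + near d q v"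
    unfolding g near_def eq using z K ends t by auto
qed

lemma glue_diff_le:
  assumes "p \<in> points" "q \<in> points" "\<not> same p q"
  shows "glue d p q \<le> max (near d p v) (near d q v)"
proof (cases "v = src p \<or> v = tgt p")
  case False
  then have "near d p v = 1" by (simp add: near_other)
  moreover have "glue d p q \<le> 1"
    using assms near_le1[of p "src p"] near_le1[of q "src p"] by (simp add: glue_def)
  ultimately show ?thesis by simp
qed (use assms in \<open>auto simp: glue_def\<close>)

lemma glue_diff_attained:
  assumes "p \<in> points" "\<not> same p q"
  obtains v where "v \<in> V" "v = src p \<or> v = tgt p" "glue d p q = max (near d p v) (near d q v)"
proof -
  have "glue d p q = max (near d p (src p)) (near d q (src p))
      \<or> glue d p q = max (near d p (tgt p)) (near d q (tgt p))"
    using assms by (auto simp: glue_def min_def)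
  then show thesis using that src_in tgt_in assms(1) by blast
qed

lemma glue_refl: "p \<in> points \<Longrightarrow> glue d p p = 0"
  by (simp add: glue_def body_in d_props)

lemma glue_sym:
  assumes "p \<in> points" "q \<in> points"
  shows "glue d p q = glue d q p"
proof (cases "same p q")
  case True
  then show ?thesis using assms same_sym[OF True] by (simp add: glue_def body_in d_props(4))
next
  case False
  then have F: "\<not> same q p" using same_sym by blast
  obtain v where v: "glue d p q = max (near d p v) (near d q v)"
    using glue_diff_attained[OF assms(1) False] by metis
  obtain u where u: "glue d q p = max (near d q u) (near d p u)"
    using glue_diff_attained[OF assms(2) F] by metis
  show ?thesis
    using glue_diff_le[OF assms False, of u] glue_diff_le[OF assms(2,1) F, of v] u v by auto
qed

lemma glue_ge0:
  assumes "p \<in> points" "q \<in> points"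
  shows "0 \<le> glue d p q"
  using assms near_ge0[of p "src p"] near_ge0[of p "tgt p"]
  by (auto simp: glue_def body_in d_props(2))

lemma glue_le1:
  assumes "p \<in> points" "q \<in> points"
  shows "glue d p q \<le> 1"
  using assms near_le1[of p "src p"] near_le1[of q "src p"]
  by (auto simp: glue_def body_in d_props(3))

lemma glue_triangle:
  assumes "p \<in> points" "q \<in> points" "r \<in> points"
  shows "glue d p r \<le> glue d p q + glue d q r"
proof -
  have one: "glue d x z \<le> glue d x y + glue d y z"
    if "x \<in> points" "y \<in> points" "z \<in> points" "same x y" and diff: "\<not> same y z" for x y z
  proof -
    obtain v where v: "glue d y z = max (near d y v) (near d z v)"
      using glue_diff_attained[OF \<open>y \<in> points\<close> diff] by metis
    have "\<not> same x z" using that diff same_sym same_trans by blast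
    then have "glue d x z \<le> max (near d x v) (near d z v)" using that glue_diff_le by blast
    also have "\<dots> \<le> glue d x y + glue d y z"
      using same_near(1)[of x y v] glue_ge0[of x y] that v by auto
    finally show ?thesis .
  qed
  consider "same p q" "same q r" | "same p q" "\<not> same q r" | "\<not> same p q" "same q r"
    | "\<not> same p q" "\<not> same q r" by blast
  then show ?thesis
  proof cases
    case 1
    then have "same p r" using same_trans by blast
    then show ?thesis using 1 assms by (simp add: glue_def body_in d_props(5))
  next
    case 2
    then show ?thesis using one assms by blast
  next
    case 3
    then have "glue d r p \<le> glue d r q + glue d q p"
      using one[of r q p] assms same_sym by blast
    then show ?thesis using glue_sym assms by simp
  next
    case 4
    obtain v where v: "glue d p q = max (near d p v) (near d q v)"
      using glue_diff_attained[of p q] assms(1) 4 by metis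
    obtain u where u: "glue d q r = max (near d q u) (near d r u)"
      using glue_diff_attained[of q r] assms(2) 4 by metis
    show ?thesis
    proof (cases "u = v")
      case False
      then show ?thesis
        using near_sum[of q v u] glue_le1[of p r] assms u v by auto
    next
      case True
      then show ?thesis
        using same_near(2)[of p r v] glue_diff_le[of p r v] near_ge0[of p v] near_ge0[of r v]
          near_ge0[of q v] assms u v by (cases "same p r") auto
    qed
  qed
qed

lemma unit_pmetric_glue: "unit_pmetric points (glue d)"
  unfolding unit_pmetric_def
  using glue_refl glue_ge0 glue_le1 glue_sym glue_triangle by blast

lemma glue_vx:
  assumes "p \<in> points" "v \<in> V"
  shows "glue d p (vx v) = near d p v"
proof (cases "same p (vx v)")
  case True
  then have "p = vx v" using assms same_eqI[of p "vx v"] by (simp add: same_def)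
  then show ?thesis using assms by (simp add: glue_refl)
next
  case False
  have "near d p v \<le> glue d p (vx v)"
    using glue_diff_attained[OF assms(1) False] near_le1[OF assms(1), of v]
    by (metis max.cobounded1 max.cobounded2 near_vx order_trans)
  moreover have "glue d p (vx v) \<le> near d p v"
    using glue_diff_le[OF assms(1) _ False, of v] near_ge0[OF assms(1), of v] assms by simp
  ultimately show ?thesis by simp
qed

lemma glue_embed:
  assumes e: "edge s t w" and K: "k \<in> K" "l \<in> K"
  shows "glue d (embed s t w k) (embed s t w l) = d k l"
proof -
  have st: "s \<noteq> t" "t \<in> V" using edgeD[OF e] by auto
  have A: "glue d (mk s t w x) (vx t) = d x b" if "x \<in> K" "x \<noteq> b" for x
    using glue_vx[OF mk_in[OF e that]] st by (simp add: near_mk[OF e])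
  have B: "glue d (vx t) (mk s t w x) = d b x" if "x \<in> K" "x \<noteq> b" for x
    using A[OF that] glue_sym[OF mk_in[OF e that], of "vx t"] st ends that by (simp add: d_props(4))
  have C: "glue d (mk s t w k) (mk s t w l) = d k l"
    by (simp add: glue_def same_def wt_mk[OF e])
  show ?thesis
    using A B C K st by (auto simp: embed_def glue_refl d_props)
qed

end

definition is_Cauchy :: "('k \<Rightarrow> 'k \<Rightarrow> real) \<Rightarrow> (nat \<Rightarrow> 'k) \<Rightarrow> bool" where
  "is_Cauchy d \<sigma> \<longleftrightarrow> (\<forall>e>0. \<exists>N. \<forall>m\<ge>N. \<forall>n\<ge>N. d (\<sigma> m) (\<sigma> n) < e)"

lemma is_CauchyD: "is_Cauchy d \<sigma> \<Longrightarrow> 0 < e \<Longrightarrow> \<exists>N. \<forall>m\<ge>N. \<forall>n\<ge>N. d (\<sigma> m) (\<sigma> n) < e"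
  by (simp add: is_Cauchy_def)

definition complete_on :: "'k set \<Rightarrow> ('k \<Rightarrow> 'k \<Rightarrow> real) \<Rightarrow> bool" where
  "complete_on K d \<longleftrightarrow>
     (\<forall>\<sigma>. (\<forall>n. \<sigma> n \<in> K) \<and> is_Cauchy d \<sigma> \<longrightarrow> (\<exists>x\<in>K. (\<lambda>n. d (\<sigma> n) x) \<longlonglongrightarrow> 0))"

context web_pmetric
begin

text \<open>Separation from the end \<open>b\<close> is assumed in place of separation of all points: this lemma is the step
by which the metric of the self-similar block is shown to separate points.\<close>

lemma near_zero:
  assumes "\<And>k. k \<in> K \<Longrightarrow> d k b = 0 \<Longrightarrow> k = b" "p \<in> points" "near d p v = 0"
  shows "p = vx v"
  using assms(2)
proof (cases rule: points_cases)
  case (vertex u)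
  then show ?thesis using assms(3) by (simp split: if_splits)
next
  case (edge s t w k)
  then show ?thesis using assms(1,3) edgeD[of s t w] by (auto simp: near_mk split: if_splits)
qed

text \<open>Every point of a block, the second end being replaced by a vertex, has positive distance
to both vertices adjacent to the block, and other blocks are reached only near these vertices.\<close>

lemma edge_block_open:
  assumes "\<And>k. k \<in> K \<Longrightarrow> d k b = 0 \<Longrightarrow> k = b" and p: "p \<in> points" "src p \<noteq> tgt p"
  obtains r where "0 < r" "\<And>q. q \<in> points \<Longrightarrow> glue d p q < r \<Longrightarrow> same p q"
proof
  have "0 < near d p v" for v
  proof (rule ccontr)
    assume "\<not> 0 < near d p v"
    then have "near d p v = 0" using near_ge0[OF p(1), of v] by linarith
    then have "p = vx v" using near_zero assms(1) p(1) by blast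
    then show False using p(2) by simp
  qed
  then show "0 < min (near d p (src p)) (near d p (tgt p))" by simp
  show "same p q" if "q \<in> points" "glue d p q < min (near d p (src p)) (near d p (tgt p))" for q
  proof (rule ccontr)
    assume "\<not> same p q"
    from glue_diff_attained[OF p(1) this] show False using that(2) by force
  qed
qed

text \<open>A Cauchy sequence that keeps changing its block passes close to a vertex at each change, and by
\<open>near_unique\<close> this is always the same vertex.\<close>

lemma Cauchy_near_vertex:
  fixes \<sigma> :: "nat \<Rightarrow> _"
  assumes P: "\<And>n. \<sigma> n \<in> points"
    and C: "is_Cauchy (glue d) \<sigma>"
    and diff: "\<And>n. \<exists>m\<ge>n. \<not> same (\<sigma> n) (\<sigma> m)"
  obtains v where "v \<in> V" "(\<lambda>n. near d (\<sigma> n) v) \<longlonglongrightarrow> 0"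
proof -
  have common: "\<exists>v\<in>V. near d (\<sigma> m) v < e \<and> near d (\<sigma> n) v < e"
    if lt: "glue d (\<sigma> m) (\<sigma> n) < e" and ns: "\<not> same (\<sigma> m) (\<sigma> n)" for m n e
  proof -
    obtain v where "v \<in> V" "glue d (\<sigma> m) (\<sigma> n) = max (near d (\<sigma> m) v) (near d (\<sigma> n) v)"
      using glue_diff_attained[OF P ns] by metis
    then show ?thesis using lt by auto
  qed
  obtain M where M: "\<And>m n. m \<ge> M \<Longrightarrow> n \<ge> M \<Longrightarrow> glue d (\<sigma> m) (\<sigma> n) < 1/2"
    using is_CauchyD[OF C, of "1/2"] by auto
  obtain m0 where m0: "m0 \<ge> M" "\<not> same (\<sigma> M) (\<sigma> m0)" using diff by blast
  have "glue d (\<sigma> M) (\<sigma> m0) < 1/2" using M[of M m0] m0(1) by simp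
  from common[OF this m0(2)]
  obtain v where v: "v \<in> V" "near d (\<sigma> M) v < 1/2" "near d (\<sigma> m0) v < 1/2"
    by blast
  have half: "near d (\<sigma> n) v < 1/2" if n: "n \<ge> M" for n
  proof -
    obtain k where k: "k \<ge> M" "near d (\<sigma> k) v < 1/2" "\<not> same (\<sigma> n) (\<sigma> k)"
    proof (cases "same (\<sigma> n) (\<sigma> M)")
      case True
      then have "\<not> same (\<sigma> n) (\<sigma> m0)" using m0(2) same_sym same_trans by blast
      then show ?thesis using that m0(1) v(3) by blast
    qed (use that v(2) in blast)
    have "glue d (\<sigma> n) (\<sigma> k) < 1/2" using M[of n k] n k(1) by simp
    from common[OF this k(3)]
    obtain u where "near d (\<sigma> n) u < 1/2" "near d (\<sigma> k) u < 1/2"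
      by blast
    then show ?thesis using near_unique[OF P k(2)] by blast
  qed
  have "\<exists>N. \<forall>n\<ge>N. near d (\<sigma> n) v < e" if "0 < e" for e
  proof -
    obtain N where N: "\<And>m n. m \<ge> N \<Longrightarrow> n \<ge> N \<Longrightarrow> glue d (\<sigma> m) (\<sigma> n) < min e (1/2)"
      using is_CauchyD[OF C, of "min e (1/2)"] \<open>0 < e\<close> by auto
    have "near d (\<sigma> n) v < e" if n: "n \<ge> max M N" for n
    proof -
      obtain k where k: "k \<ge> n" "\<not> same (\<sigma> n) (\<sigma> k)" using diff by blast
      obtain u where u: "near d (\<sigma> n) u < min e (1/2)"
        using common[OF N[of n k] k(2)] n k(1) by auto
      then have "u = v" using near_unique[OF P, of n u v] half[of n] n by auto
      then show ?thesis using u by simp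
    qed
    then show ?thesis by blast
  qed
  then have "(\<lambda>n. near d (\<sigma> n) v) \<longlonglongrightarrow> 0"
    using near_ge0[OF P] by (simp add: LIMSEQ_iff)
  then show thesis using that v(1) by blast
qed

end

context web
begin

lemma near_mono:
  assumes "\<And>x y. x \<in> K \<Longrightarrow> y \<in> K \<Longrightarrow> d x y \<le> d' x y" "p \<in> points"
  shows "near d p v \<le> near d' p v"
proof -
  have "d (body p) a \<le> d' (body p) a" "d (body p) b \<le> d' (body p) b"
    using assms body_in ends by auto
  then show ?thesis unfolding near_def by auto
qed

lemma glue_mono:
  assumes "\<And>x y. x \<in> K \<Longrightarrow> y \<in> K \<Longrightarrow> d x y \<le> d' x y" "p \<in> points" "q \<in> points"
  shows "glue d p q \<le> glue d' p q"
proof -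
  have "d (body p) (body q) \<le> d' (body p) (body q)" using assms body_in by blast
  moreover have "near d p v \<le> near d' p v" "near d q v \<le> near d' q v" for v
    using near_mono[of d d'] assms by blast+
  ultimately show ?thesis
    unfolding glue_def by (cases "same p q") (simp_all only: if_True if_False min.mono max.mono)
qed

lemma near_tendsto:
  assumes "\<And>x y. x \<in> K \<Longrightarrow> y \<in> K \<Longrightarrow> (\<lambda>n. D n x y) \<longlonglongrightarrow> d x y" "p \<in> points"
  shows "(\<lambda>n. near (D n) p v) \<longlonglongrightarrow> near d p v"
proof -
  have "(\<lambda>n. D n (body p) a) \<longlonglongrightarrow> d (body p) a" "(\<lambda>n. D n (body p) b) \<longlonglongrightarrow> d (body p) b"
    using assms body_in ends by auto
  then show ?thesis unfolding near_def by (auto intro!: tendsto_intros)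
qed

lemma glue_tendsto:
  assumes "\<And>x y. x \<in> K \<Longrightarrow> y \<in> K \<Longrightarrow> (\<lambda>n. D n x y) \<longlonglongrightarrow> d x y" "p \<in> points" "q \<in> points"
  shows "(\<lambda>n. glue (D n) p q) \<longlonglongrightarrow> glue d p q"
proof -
  have "(\<lambda>n. D n (body p) (body q)) \<longlonglongrightarrow> d (body p) (body q)"
    using assms body_in by blast
  moreover have "(\<lambda>n. near (D n) p v) \<longlonglongrightarrow> near d p v" "(\<lambda>n. near (D n) q v) \<longlonglongrightarrow> near d q v" for v
    using near_tendsto[of D d] assms by blast+
  ultimately show ?thesis unfolding glue_def by (auto intro!: tendsto_intros)
qed

end

context web_pmetric
begin

lemma same_block_embed:
  assumes "p \<in> points" "q \<in> points" "same p q" "src p \<noteq> tgt p"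
  shows "q = embed (src p) (tgt p) (wt p) (body q)"
  using edge_eq[of q] assms by (simp add: same_def embed_def)

text \<open>If the limit inside the block is the missing end \<open>b\<close>, the sequence converges to the vertex that
replaces it; \<open>embed\<close> treats both cases alike.\<close>

lemma block_limit:
  fixes \<sigma> :: "nat \<Rightarrow> _"
  assumes P: "\<And>n. \<sigma> n \<in> points" and S: "\<And>n. n \<ge> N \<Longrightarrow> same (\<sigma> N) (\<sigma> n)"
    and e: "src (\<sigma> N) \<noteq> tgt (\<sigma> N)"
    and x: "x \<in> K" "(\<lambda>n. d (body (\<sigma> (n + N))) x) \<longlonglongrightarrow> 0"
  shows "(\<lambda>n. glue d (\<sigma> n) (embed (src (\<sigma> N)) (tgt (\<sigma> N)) (wt (\<sigma> N)) x)) \<longlonglongrightarrow> 0"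
proof (rule LIMSEQ_offset[where k = N])
  have "glue d (\<sigma> (n + N)) (embed (src (\<sigma> N)) (tgt (\<sigma> N)) (wt (\<sigma> N)) x) = d (body (\<sigma> (n + N))) x" for n
    using same_block_embed[OF P P S[of "n + N"] e] glue_embed[OF edge_eq(1)[OF P e] body_in[OF P] x(1)]
    by (metis le_add2)
  then show "(\<lambda>n. glue d (\<sigma> (n + N)) (embed (src (\<sigma> N)) (tgt (\<sigma> N)) (wt (\<sigma> N)) x)) \<longlonglongrightarrow> 0"
    using x(2) by simp
qed

lemma complete_glue:
  assumes "complete_on K d"
  shows "complete_on points (glue d)"
  unfolding complete_on_def
proof (intro allI impI, elim conjE)
  fix \<sigma> :: "nat \<Rightarrow> _"
  assume "\<forall>n. \<sigma> n \<in> points" and C: "is_Cauchy (glue d) \<sigma>"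
  then have P: "\<sigma> n \<in> points" for n by blast
  show "\<exists>x\<in>points. (\<lambda>n. glue d (\<sigma> n) x) \<longlonglongrightarrow> 0"
  proof (cases "\<forall>n. \<exists>m\<ge>n. \<not> same (\<sigma> n) (\<sigma> m)")
    case True
    then obtain v where "v \<in> V" "(\<lambda>n. near d (\<sigma> n) v) \<longlonglongrightarrow> 0"
      using Cauchy_near_vertex[OF P C] by metis
    then have "(\<lambda>n. glue d (\<sigma> n) (vx v)) \<longlonglongrightarrow> 0" using glue_vx[OF P] by simp
    then show ?thesis using \<open>v \<in> V\<close> vx_in by blast
  next
    case False
    then obtain N where N: "\<And>n. n \<ge> N \<Longrightarrow> same (\<sigma> N) (\<sigma> n)" by blast
    show ?thesis
    proof (cases "src (\<sigma> N) = tgt (\<sigma> N)")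
      case True
      then have "\<sigma> n = \<sigma> N" if "n \<ge> N" for n
        using same_eqI[OF P P N[OF that]] by metis
      then have "glue d (\<sigma> n) (\<sigma> N) = 0" if "n \<ge> N" for n
        using that glue_refl[OF P[of N]] by metis
      then have "(\<lambda>n. glue d (\<sigma> n) (\<sigma> N)) \<longlonglongrightarrow> 0"
        by (intro tendsto_eventually) (auto simp: eventually_sequentially)
      then show ?thesis using P by blast
    next
      case e: False
      have eq: "d (body (\<sigma> (m + N))) (body (\<sigma> (n + N))) = glue d (\<sigma> (m + N)) (\<sigma> (n + N))" for m n
        using N[of "m + N"] N[of "n + N"] same_sym same_trans unfolding glue_def by (metis le_add2)
      have "is_Cauchy d (\<lambda>n. body (\<sigma> (n + N)))"
        unfolding is_Cauchy_def eq using is_CauchyD[OF C] by (meson trans_le_add1)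
      moreover have "\<forall>n. body (\<sigma> (n + N)) \<in> K" using body_in[OF P] by simp
      ultimately have "\<exists>x\<in>K. (\<lambda>n. d (body (\<sigma> (n + N))) x) \<longlonglongrightarrow> 0"
        using assms[unfolded complete_on_def, rule_format, of "\<lambda>n. body (\<sigma> (n + N))"] by simp
      then obtain x where "x \<in> K" "(\<lambda>n. d (body (\<sigma> (n + N))) x) \<longlonglongrightarrow> 0"
        by blast
      then show ?thesis
        using block_limit[where \<sigma> = \<sigma> and N = N, OF P N e] embed_in[OF edge_eq(1)[OF P e]] by blast
    qed
  qed
qed

lemma glue_zero:
  assumes zero: "\<And>k l. k \<in> K \<Longrightarrow> l \<in> K \<Longrightarrow> d k l = 0 \<Longrightarrow> k = l"
    and P: "p \<in> points" "q \<in> points" and g: "glue d p q = 0"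
  shows "p = q"
proof (cases "same p q")
  case True
  then have "body p = body q" using g zero[OF body_in body_in] P by (simp add: glue_def)
  then show ?thesis using same_eqI[OF P True] by simp
next
  case False
  obtain v where v: "glue d p q = max (near d p v) (near d q v)"
    using glue_diff_attained[OF P(1) False] by metis
  then have "near d p v = 0" "near d q v = 0"
    using g near_ge0[OF P(1), of v] near_ge0[OF P(2), of v] by auto
  then have "p = vx v" "q = vx v" using near_zero zero ends(2) P by blast+
  then show ?thesis by simp
qed

end

section \<open>The self-similar block\<close>

type_synonym word = "nat \<Rightarrow> real \<times> real"

definition vtx :: "real \<Rightarrow> word" where "vtx t = (\<lambda>_. (t, t))"
text \<open>A web stores the weight of an edge separately; here \<open>fwt\<close> recovers it from \<open>s\<close> and \<open>t\<close>.\<close>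

definition prefix :: "real \<Rightarrow> real \<Rightarrow> real \<Rightarrow> word \<Rightarrow> word" where
  "prefix s t w p = case_nat (s, t) p"
definition fsrc :: "word \<Rightarrow> real" where "fsrc p = fst (p 0)"
definition ftgt :: "word \<Rightarrow> real" where "ftgt p = snd (p 0)"
definition fwt :: "word \<Rightarrow> real" where "fwt p = \<bar>fsrc p - ftgt p\<bar>"
definition shift :: "word \<Rightarrow> word" where "shift p = (\<lambda>i. p (Suc i))"
text \<open>No edge leads to the vertex \<open>1\<close>. Otherwise blocks hanging on \<open>1\<close> inside blocks hanging
on \<open>1\<close> and so on would all contain the vertex \<open>1\<close> while their diameters tend to \<open>0\<close>, and a
nested sequence of them would define a point at distance \<open>0\<close> from that vertex.\<close>

definition fedge :: "real \<Rightarrow> real \<Rightarrow> real \<Rightarrow> bool" where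
  "fedge s t w \<longleftrightarrow> s \<in> {0..1} \<and> t \<in> {0..1} \<and> s \<noteq> t \<and> t \<noteq> 1 \<and> w = \<bar>s - t\<bar>"
text \<open>A digit \<open>(s, t)\<close> with \<open>s \<noteq> t\<close> says that the point lies in the block over the edge from \<open>s\<close> to
\<open>t\<close>, where the remaining digits describe it; the constant sequence \<open>(t, t)\<close> is the vertex \<open>t\<close>. As the end
\<open>1\<close> of a block is identified with the vertex on which the block hangs, the digit \<open>(1, 1)\<close>
does not follow an edge.\<close>

definition fabric :: "word set" where
  "fabric = {p. \<forall>i. fst (p i) \<in> {0..1} \<and> snd (p i) \<in> {0..1} \<and>
     (if fst (p i) = snd (p i) then p (Suc i) = p i else snd (p i) \<noteq> 1 \<and> p (Suc i) \<noteq> (1, 1))}"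

lemma vtx_in_fabric: "t \<in> {0..1} \<Longrightarrow> vtx t \<in> fabric"
  by (simp add: fabric_def vtx_def)

lemma vtx_eq_iff [simp]: "vtx s = vtx t \<longleftrightarrow> s = t"
  by (auto simp: vtx_def fun_eq_iff)

lemma shift_vtx [simp]: "shift (vtx t) = vtx t"
  by (simp add: shift_def vtx_def)

lemma shift_prefix [simp]: "shift (prefix s t w p) = p"
  by (simp add: shift_def prefix_def)

lemma ends_vtx [simp]: "fsrc (vtx t) = t" "ftgt (vtx t) = t"
  by (simp_all add: fsrc_def ftgt_def vtx_def)

lemma ends_prefix [simp]: "fsrc (prefix s t w p) = s" "ftgt (prefix s t w p) = t"
  by (simp_all add: fsrc_def ftgt_def prefix_def)

interpretation fab: web "{0..1}" fedge fabric "vtx 0" "vtx 1" vtx prefix fsrc ftgt fwt shift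
  by unfold_locales (auto simp: fedge_def vtx_in_fabric fwt_def)

lemma shift_in_fabric: "p \<in> fabric \<Longrightarrow> shift p \<in> fabric"
  by (simp add: fabric_def shift_def)

lemma fabric_vertex:
  assumes "p \<in> fabric" "fst (p 0) = snd (p 0)"
  shows "p = vtx (snd (p 0))"
proof -
  have "p i = p 0" for i
  proof (induction i)
    case (Suc i)
    then show ?case using assms by (auto simp: fabric_def split: if_splits)
  qed simp
  then show ?thesis using assms(2) unfolding vtx_def by (metis prod.collapse)
qed

lemma fabric_points: "fab.points = fabric"
proof (intro equalityI subsetI)
  fix p assume "p \<in> fab.points"
  then show "p \<in> fabric"
  proof (cases rule: fab.points_cases)
    case (edge s t w k)
    have "k 0 \<noteq> (1, 1)"
      using fabric_vertex[of k] edge by auto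
    then show ?thesis
      using edge by (auto simp: fabric_def prefix_def fedge_def split: nat.split)
  qed (simp add: vtx_in_fabric)
next
  fix p assume p: "p \<in> fabric"
  show "p \<in> fab.points"
  proof (cases "fst (p 0) = snd (p 0)")
    case True
    have "snd (p 0) \<in> {0..1}" using p by (auto simp: fabric_def)
    then show ?thesis using fabric_vertex[OF p True] fab.vx_in by metis
  next
    case False
    have "p 1 \<noteq> (1, 1)" and e: "fedge (fst (p 0)) (snd (p 0)) (fwt p)"
      using p False by (auto simp: fabric_def fedge_def fwt_def fsrc_def ftgt_def)
    then have "shift p \<noteq> vtx 1" by (auto simp: shift_def vtx_def fun_eq_iff)
    moreover have "p = prefix (fst (p 0)) (snd (p 0)) (fwt p) (shift p)"
      by (auto simp: prefix_def shift_def fun_eq_iff split: nat.split)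
    ultimately show ?thesis
      using fab.mk_in[OF e shift_in_fabric[OF p]] by simp
  qed
qed

lemma ftgt_in: "p \<in> fabric \<Longrightarrow> ftgt p \<in> {0..1}"
  using fab.tgt_in fabric_points by blast

text \<open>The blocks are reduced by the factor \<open>1/2\<close>, and the distance of the vertices underneath in
\<open>[0,1]\<close> keeps the two ends of the whole at distance \<open>1\<close>, so that the step can be iterated.
Starting from a pseudometric that only sees the vertex underneath, the iteration increases.\<close>

primrec fdist_approx :: "nat \<Rightarrow> word \<Rightarrow> word \<Rightarrow> real" where
  "fdist_approx 0 = (\<lambda>p q. \<bar>ftgt p - ftgt q\<bar>)"
| "fdist_approx (Suc n) = (\<lambda>p q. max \<bar>ftgt p - ftgt q\<bar> (fab.glue (fdist_approx n) p q / 2))"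

definition fdist :: "word \<Rightarrow> word \<Rightarrow> real" where
  "fdist p q = lim (\<lambda>n. fdist_approx n p q)"

lemma unit_pmetric_step:
  assumes "unit_pmetric fabric e"
  shows "unit_pmetric fabric (\<lambda>p q. max \<bar>ftgt p - ftgt q\<bar> (e p q / 2))"
proof -
  note * = unit_pmetricD[OF assms]
  have b: "\<bar>ftgt p - ftgt q\<bar> \<le> 1" if "p \<in> fabric" "q \<in> fabric" for p q
    using ftgt_in[OF that(1)] ftgt_in[OF that(2)] by auto
  have "max \<bar>ftgt p - ftgt r\<bar> (e p r / 2)
      \<le> max \<bar>ftgt p - ftgt q\<bar> (e p q / 2) + max \<bar>ftgt q - ftgt r\<bar> (e q r / 2)"
    if "p \<in> fabric" "q \<in> fabric" "r \<in> fabric" for p q r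
  proof -
    have "\<bar>ftgt p - ftgt r\<bar> \<le> \<bar>ftgt p - ftgt q\<bar> + \<bar>ftgt q - ftgt r\<bar>" by linarith
    moreover have "e p r / 2 \<le> e p q / 2 + e q r / 2" using *(5)[of p q r] that by simp
    ultimately show ?thesis by linarith
  qed
  moreover have "max \<bar>ftgt p - ftgt q\<bar> (e p q / 2) \<le> 1" if "p \<in> fabric" "q \<in> fabric" for p q
    using b[OF that] *(3)[OF that] by simp
  ultimately show ?thesis
    unfolding unit_pmetric_def using * by (auto simp: abs_minus_commute)
qed

lemma fdist_approx_unit_pmetric: "unit_pmetric fabric (fdist_approx n) \<and> fdist_approx n (vtx 0) (vtx 1) = 1"
proof (induction n)
  case 0
  have "unit_pmetric fabric (\<lambda>p q. 0)" by (simp add: unit_pmetric_def)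
  from unit_pmetric_step[OF this] show ?case by simp
next
  case (Suc n)
  interpret web_pmetric "{0..1}" fedge fabric "vtx 0" "vtx 1" vtx prefix fsrc ftgt fwt shift "fdist_approx n"
    using Suc by unfold_locales auto
  have "fab.glue (fdist_approx n) (vtx 0) (vtx 1) \<le> 1"
    using glue_le1[of "vtx 0" "vtx 1"] by simp
  then show ?case
    using unit_pmetric_step unit_pmetric_glue by (simp add: fabric_points)
qed

lemma fdist_approx_mono:
  "p \<in> fabric \<Longrightarrow> q \<in> fabric \<Longrightarrow> fdist_approx n p q \<le> fdist_approx (Suc n) p q"
proof (induction n arbitrary: p q)
  case (Suc n)
  have "fab.glue (fdist_approx n) p q \<le> fab.glue (fdist_approx (Suc n)) p q"
    by (rule fab.glue_mono) (use Suc in \<open>auto simp: fabric_points\<close>)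
  then have "max c (fab.glue (fdist_approx n) p q / 2) \<le> max c (fab.glue (fdist_approx (Suc n)) p q / 2)" for c
    by (intro max.mono) auto
  then show ?case by (simp only: fdist_approx.simps)
qed auto

lemma fdist_approx_tendsto:
  assumes "p \<in> fabric" "q \<in> fabric"
  shows "(\<lambda>n. fdist_approx n p q) \<longlonglongrightarrow> fdist p q"
proof -
  have "incseq (\<lambda>n. fdist_approx n p q)" using fdist_approx_mono[OF assms] by (intro incseq_SucI)
  moreover have "fdist_approx n p q \<le> 1" for n
    using unit_pmetricD(3)[OF conjunct1[OF fdist_approx_unit_pmetric] assms] .
  ultimately obtain L where "(\<lambda>n. fdist_approx n p q) \<longlonglongrightarrow> L"
    using incseq_convergent[of "\<lambda>n. fdist_approx n p q" 1] by blast
  then show ?thesis unfolding fdist_def by (simp add: limI)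
qed

lemma fdist_rec:
  assumes "p \<in> fabric" "q \<in> fabric"
  shows "fdist p q = max \<bar>ftgt p - ftgt q\<bar> (fab.glue fdist p q / 2)"
proof -
  have "(\<lambda>n. fab.glue (fdist_approx n) p q) \<longlonglongrightarrow> fab.glue fdist p q"
    by (rule fab.glue_tendsto) (use assms fdist_approx_tendsto in \<open>auto simp: fabric_points\<close>)
  then have "(\<lambda>n. fdist_approx (Suc n) p q) \<longlonglongrightarrow> max \<bar>ftgt p - ftgt q\<bar> (fab.glue fdist p q / 2)"
    by (auto intro!: tendsto_intros)
  moreover have "(\<lambda>n. fdist_approx (Suc n) p q) \<longlonglongrightarrow> fdist p q"
    using fdist_approx_tendsto[OF assms] by (rule LIMSEQ_Suc)
  ultimately show ?thesis using LIMSEQ_unique by blast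
qed

lemma unit_pmetric_limit:
  assumes "\<And>n. unit_pmetric K (D n)" "\<And>x y. x \<in> K \<Longrightarrow> y \<in> K \<Longrightarrow> (\<lambda>n. D n x y) \<longlonglongrightarrow> d x y"
  shows "unit_pmetric K d"
  unfolding unit_pmetric_def
proof (intro conjI ballI)
  note * = unit_pmetricD[OF assms(1)]
  show "d x x = 0" if "x \<in> K" for x
    using assms(2)[OF that that] *(1)[OF that] LIMSEQ_unique[of "\<lambda>n. D n x x"] by fastforce
  fix x y assume xy: "x \<in> K" "y \<in> K"
  show "0 \<le> d x y" by (rule LIMSEQ_le_const[OF assms(2)]) (use xy * in auto)
  show "d x y \<le> 1" by (rule LIMSEQ_le_const2[OF assms(2)]) (use xy * in auto)
  have "(\<lambda>n. D n x y) = (\<lambda>n. D n y x)" using *(4) xy by auto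
  then show "d x y = d y x" using assms(2)[OF xy] assms(2)[OF xy(2,1)] LIMSEQ_unique by metis
  fix z assume "z \<in> K"
  show "d x z \<le> d x y + d y z"
    by (rule LIMSEQ_le[OF assms(2) tendsto_add[OF assms(2) assms(2)]])
      (use xy \<open>z \<in> K\<close> *(5) in auto)
qed

lemma fdist_unit_pmetric: "unit_pmetric fabric fdist"
  using unit_pmetric_limit[of fabric fdist_approx fdist] fdist_approx_unit_pmetric fdist_approx_tendsto by blast

interpretation fab: web_pmetric "{0..1}" fedge fabric "vtx 0" "vtx 1" vtx prefix fsrc ftgt fwt shift fdist
proof
  show "unit_pmetric fabric fdist" by (rule fdist_unit_pmetric)
  have "(\<lambda>n. fdist_approx n (vtx 0) (vtx 1)) = (\<lambda>n. 1)" using fdist_approx_unit_pmetric by auto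
  then show "fdist (vtx 0) (vtx 1) = 1"
    using fdist_approx_tendsto[of "vtx 0" "vtx 1"] fab.ends LIMSEQ_unique[of "\<lambda>_. 1::real"] by fastforce
qed

lemma fdist_same:
  assumes "p \<in> fabric" "q \<in> fabric" "p 0 = q 0"
  shows "fdist p q = fdist (shift p) (shift q) / 2"
proof -
  have "0 \<le> fdist (shift p) (shift q)"
    using assms shift_in_fabric fab.d_props(2) by blast
  moreover have "fab.same p q" using assms(3) by (simp add: fab.same_def fsrc_def ftgt_def fwt_def)
  ultimately show ?thesis
    using fdist_rec[OF assms(1,2)] assms(3) by (simp add: fab.glue_def ftgt_def)
qed

lemma fab_same_iff: "fab.same p q \<longleftrightarrow> p 0 = q 0"
  by (auto simp: fab.same_def fsrc_def ftgt_def fwt_def prod_eq_iff)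

text \<open>This is where it matters that no edge leads to the vertex \<open>1\<close>: a point of a block is separated
from that vertex by a jump, if the block starts there, or else is not attached to it at all.\<close>

lemma fdist_end_zero:
  assumes "p \<in> fabric" "fdist p (vtx 1) = 0"
  shows "p = vtx 1"
proof -
  have p: "p \<in> fab.points" using assms fabric_points by simp
  have "fab.near fdist p 1 = 0"
    using fdist_rec[OF assms(1), of "vtx 1"] assms fab.ends fab.glue_vx[OF p, of 1] fab.near_ge0[OF p, of 1]
    by (simp add: max_def split: if_splits)
  with p show ?thesis
  proof (cases rule: fab.points_cases)
    case (edge s t w k)
    then show ?thesis
      using \<open>fab.near fdist p 1 = 0\<close> fab.edgeD[OF edge(1)]
      by (auto simp: fab.near_mk fedge_def max_def split: if_splits)
  qed (simp split: if_splits)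
qed

lemma fdist_zero:
  assumes "p \<in> fabric" "q \<in> fabric" "fdist p q = 0"
  shows "p = q"
proof -
  have first: "p 0 = q 0" if "p \<in> fabric" "q \<in> fabric" "fdist p q = 0" for p q
  proof (rule ccontr)
    assume ne: "p 0 \<noteq> q 0"
    have pq: "p \<in> fab.points" "q \<in> fab.points" using that fabric_points by auto
    have "fab.glue fdist p q \<le> 0" using fdist_rec[OF that(1,2)] that(3) by linarith
    moreover obtain v where "fab.glue fdist p q = max (fab.near fdist p v) (fab.near fdist q v)"
      using fab.glue_diff_attained[OF pq(1), of q] ne fab_same_iff by metis
    ultimately have "fab.near fdist p v = 0" "fab.near fdist q v = 0"
      using fab.near_ge0[OF pq(1), of v] fab.near_ge0[OF pq(2), of v] by auto
    then have "p = vtx v" "q = vtx v" using fab.near_zero fdist_end_zero pq by blast+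
    then show False using ne by simp
  qed
  have "p i = q i" for i
    using assms
  proof (induction i arbitrary: p q)
    case 0 then show ?case using first by blast
  next
    case (Suc i)
    have "shift p \<in> fabric" "shift q \<in> fabric" using Suc.prems shift_in_fabric by auto
    moreover have "fdist (shift p) (shift q) = 0"
      using fdist_same[OF Suc.prems(1,2) first[OF Suc.prems]] Suc.prems(3) by simp
    ultimately show ?case using Suc.IH[of "shift p" "shift q"] by (simp add: shift_def)
  qed
  then show ?thesis by auto
qed

section \<open>Completeness of the self-similar block\<close>

lemma fdist_agree:
  assumes "p \<in> fabric" "q \<in> fabric" "\<And>i. i < k \<Longrightarrow> p i = q i"
  shows "fdist p q \<le> (1/2) ^ k"
  using assms
proof (induction k arbitrary: p q)
  case 0
  then show ?case using fab.d_props(3) by simp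
next
  case (Suc k)
  have "fdist (shift p) (shift q) \<le> (1/2) ^ k"
    by (rule Suc.IH) (use Suc.prems shift_in_fabric in \<open>auto simp: shift_def\<close>)
  then show ?case using fdist_same[OF Suc.prems(1,2)] Suc.prems(3)[of 0] by simp
qed

lemma fdist_vtx:
  assumes "p \<in> fabric" "v \<in> {0..1}"
  shows "fdist p (vtx v) = max \<bar>ftgt p - v\<bar> (fab.near fdist p v / 2)"
  using fdist_rec[OF assms(1) vtx_in_fabric[OF assms(2)]] fab.glue_vx assms fabric_points by simp

text \<open>The jump \<open>|s - t|\<close> is part of \<open>near\<close>. Hence a sequence that approaches a vertex \<open>v\<close> inside
different blocks also converges to \<open>v\<close> in the interval underneath.\<close>

lemma fdist_vtx_le_near:
  assumes "p \<in> fabric" "v \<in> {0..1}"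
  shows "fdist p (vtx v) \<le> fab.near fdist p v"
proof -
  have p: "p \<in> fab.points" using assms fabric_points by simp
  then have "\<bar>ftgt p - v\<bar> \<le> fab.near fdist p v"
  proof (cases rule: fab.points_cases)
    case (vertex u)
    then show ?thesis using assms by auto
  next
    case (edge s t w k)
    then have "0 \<le> fdist k (vtx 1)" using fab.d_props(2) fab.ends by blast
    then show ?thesis using edge assms by (auto simp: fab.near_mk fedge_def)
  qed
  then show ?thesis using fdist_vtx[OF assms] fab.near_ge0[OF p, of v] by auto
qed

lemma fdist_embed:
  assumes "fedge s t w" "k \<in> fabric" "l \<in> fabric"
  shows "fdist (fab.embed s t w k) (fab.embed s t w l) = fdist k l / 2"
  using fdist_rec[of "fab.embed s t w k" "fab.embed s t w l"] fab.embed_in[OF assms(1)] assms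
    fab.glue_embed[OF assms] fab.d_props(2)[OF assms(2,3)] by (simp add: fabric_points)

lemma fab_glue_le: "p \<in> fabric \<Longrightarrow> q \<in> fabric \<Longrightarrow> fab.glue fdist p q \<le> 2 * fdist p q"
  using fdist_rec[of p q] by linarith

lemma fabric_limit_unstable_first:
  assumes "\<And>n. \<sigma> n \<in> fabric" "is_Cauchy fdist \<sigma>" "\<And>N. \<exists>n\<ge>N. \<sigma> n 0 \<noteq> \<sigma> N 0"
  shows "\<exists>x\<in>fabric. (\<lambda>n. fdist (\<sigma> n) x) \<longlonglongrightarrow> 0"
proof -
  have P: "\<sigma> n \<in> fab.points" for n using fabric_points assms(1) by simp
  have "\<exists>N. \<forall>m\<ge>N. \<forall>n\<ge>N. fab.glue fdist (\<sigma> m) (\<sigma> n) < e" if "0 < e" for e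
  proof -
    obtain N where "\<forall>m\<ge>N. \<forall>n\<ge>N. fdist (\<sigma> m) (\<sigma> n) < e / 2"
      using is_CauchyD[OF assms(2), of "e / 2"] \<open>0 < e\<close> by auto
    then have "\<forall>m\<ge>N. \<forall>n\<ge>N. fab.glue fdist (\<sigma> m) (\<sigma> n) < e"
      using fab_glue_le[OF assms(1) assms(1)] by (smt (verit) field_sum_of_halves)
    then show ?thesis by blast
  qed
  then have C: "is_Cauchy (fab.glue fdist) \<sigma>" by (simp add: is_Cauchy_def)
  have "\<exists>m\<ge>n. \<not> fab.same (\<sigma> n) (\<sigma> m)" for n using assms(3)[of n] fab_same_iff by metis
  then obtain v where v: "v \<in> {0..1}" "(\<lambda>n. fab.near fdist (\<sigma> n) v) \<longlonglongrightarrow> 0"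
    using fab.Cauchy_near_vertex[OF P C] by metis
  have "(\<lambda>n. fdist (\<sigma> n) (vtx v)) \<longlonglongrightarrow> 0"
  proof (rule tendsto_sandwich[OF _ _ tendsto_const v(2)])
    show "\<forall>\<^sub>F n in sequentially. 0 \<le> fdist (\<sigma> n) (vtx v)"
      using fab.d_props(2)[OF assms(1) vtx_in_fabric[OF v(1)]] by simp
    show "\<forall>\<^sub>F n in sequentially. fdist (\<sigma> n) (vtx v) \<le> fab.near fdist (\<sigma> n) v"
      using fdist_vtx_le_near[OF assms(1) v(1)] by simp
  qed
  then show ?thesis using vtx_in_fabric v(1) by blast
qed

text \<open>The first digit that does not become constant shows where the sequence changes its block
for ever, and near which vertex. The digits before it are eventually constant and are
removed one by one.\<close>

lemma fabric_limit_unstable: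
  assumes "\<And>n. \<sigma> n \<in> fabric" "is_Cauchy fdist \<sigma>" "\<And>N. \<exists>n\<ge>N. \<sigma> n k \<noteq> \<sigma> N k"
  shows "\<exists>x\<in>fabric. (\<lambda>n. fdist (\<sigma> n) x) \<longlonglongrightarrow> 0"
  using assms
proof (induction k arbitrary: \<sigma>)
  case 0
  then show ?case by (rule fabric_limit_unstable_first)
next
  case (Suc k)
  show ?case
  proof (cases "\<forall>N. \<exists>n\<ge>N. \<sigma> n 0 \<noteq> \<sigma> N 0")
    case True
    then show ?thesis using fabric_limit_unstable_first Suc.prems(1,2) by blast
  next
    case False
    then obtain N where N: "\<And>n. n \<ge> N \<Longrightarrow> \<sigma> n 0 = \<sigma> N 0" by blast
    have P: "\<sigma> n \<in> fab.points" for n using fabric_points Suc.prems by simp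
    have S: "fab.same (\<sigma> N) (\<sigma> n)" if "n \<ge> N" for n using N[OF that] fab_same_iff by simp
    have e: "fsrc (\<sigma> N) \<noteq> ftgt (\<sigma> N)"
    proof
      assume "fsrc (\<sigma> N) = ftgt (\<sigma> N)"
      then have "\<sigma> N = \<sigma> n" if "n \<ge> N" for n using fab.same_eqI[OF P P S[OF that]] by blast
      then show False using Suc.prems(3)[of N] by metis
    qed
    define \<tau> where "\<tau> = (\<lambda>n. shift (\<sigma> (n + N)))"
    have eq: "fdist (\<sigma> (m + N)) (\<sigma> (n + N)) = fdist (\<tau> m) (\<tau> n) / 2" for m n
      using fdist_same[OF Suc.prems(1,1)] N[of "m + N"] N[of "n + N"] by (simp add: \<tau>_def)
    have "\<exists>M. \<forall>m\<ge>M. \<forall>n\<ge>M. fdist (\<tau> m) (\<tau> n) < r" if "0 < r" for r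
    proof -
      obtain M where "\<forall>m\<ge>M. \<forall>n\<ge>M. fdist (\<sigma> m) (\<sigma> n) < r / 2"
        using is_CauchyD[OF Suc.prems(2), of "r / 2"] \<open>0 < r\<close> by auto
      then have "\<forall>m\<ge>M. \<forall>n\<ge>M. fdist (\<sigma> (m + N)) (\<sigma> (n + N)) < r / 2" by simp
      then show ?thesis unfolding eq by auto
    qed
    then have "is_Cauchy fdist \<tau>" by (simp add: is_Cauchy_def)
    moreover have "\<exists>n\<ge>M. \<tau> n k \<noteq> \<tau> M k" for M
    proof -
      obtain n where n: "n \<ge> M + N" "\<sigma> n (Suc k) \<noteq> \<sigma> (M + N) (Suc k)" using Suc.prems(3) by blast
      then have "\<tau> (n - N) k \<noteq> \<tau> M k" by (simp add: \<tau>_def shift_def)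
      then show ?thesis using n(1) by (metis add_le_imp_le_diff)
    qed
    moreover have "\<tau> n \<in> fabric" for n using Suc.prems(1) shift_in_fabric by (simp add: \<tau>_def)
    ultimately obtain x where x: "x \<in> fabric" "(\<lambda>n. fdist (\<tau> n) x) \<longlonglongrightarrow> 0"
      using Suc.IH by blast
    define y where "y = fab.embed (fsrc (\<sigma> N)) (ftgt (\<sigma> N)) (fwt (\<sigma> N)) x"
    have y: "y \<in> fabric" using fab.embed_in[OF fab.edge_eq(1)[OF P e] x(1)] fabric_points y_def by simp
    have "(\<lambda>n. fab.glue fdist (\<sigma> n) y) \<longlonglongrightarrow> 0"
      unfolding y_def using fab.block_limit[where \<sigma> = \<sigma> and N = N, OF P S e x(1)] x(2) \<tau>_def by blast
    then have lim: "(\<lambda>n. fab.glue fdist (\<sigma> n) y / 2) \<longlonglongrightarrow> 0" by (rule tendsto_divide_zero)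
    have "fab.glue fdist (\<sigma> n) y / 2 = fdist (\<sigma> n) y" if "n \<ge> N" for n
    proof -
      have "ftgt (\<sigma> n) = ftgt y" using N[OF that] by (simp add: y_def ftgt_def[of "\<sigma> n"] ftgt_def[of "\<sigma> N"])
      then show ?thesis
        using fdist_rec[OF Suc.prems(1) y, of n] fab.glue_ge0[OF P, of y n] y fabric_points by simp
    qed
    then have "\<forall>\<^sub>F n in sequentially. fab.glue fdist (\<sigma> n) y / 2 = fdist (\<sigma> n) y"
      by (auto simp only: eventually_sequentially)
    with lim have "(\<lambda>n. fdist (\<sigma> n) y) \<longlonglongrightarrow> 0" by (rule Lim_transform_eventually)
    then show ?thesis using y by blast
  qed
qed

text \<open>If all digits become constant, the limit is read off digit by digit, since agreement on the
first \<open>k\<close> digits forces the distance to be at most \<open>(1/2) ^ k\<close>.\<close>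

lemma fabric_complete: "complete_on fabric fdist"
  unfolding complete_on_def
proof (intro allI impI, elim conjE)
  fix \<sigma> :: "nat \<Rightarrow> word"
  assume "\<forall>n. \<sigma> n \<in> fabric" and C: "is_Cauchy fdist \<sigma>"
  then have P: "\<sigma> n \<in> fabric" for n by blast
  show "\<exists>x\<in>fabric. (\<lambda>n. fdist (\<sigma> n) x) \<longlonglongrightarrow> 0"
  proof (cases "\<exists>k. \<forall>N. \<exists>n\<ge>N. \<sigma> n k \<noteq> \<sigma> N k")
    case True
    then show ?thesis using fabric_limit_unstable[OF P C] by blast
  next
    case False
    then obtain N where N: "\<And>k n. n \<ge> N k \<Longrightarrow> \<sigma> n k = \<sigma> (N k) k" by metis
    define p where "p = (\<lambda>k. \<sigma> (N k) k)"
    have "p \<in> fabric"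
      unfolding fabric_def
    proof (intro CollectI allI)
      fix i
      define n where "n = max (N i) (N (Suc i))"
      have "p i = \<sigma> n i" "p (Suc i) = \<sigma> n (Suc i)"
        using N[of i n] N[of "Suc i" n] by (auto simp: n_def p_def)
      then show "fst (p i) \<in> {0..1} \<and> snd (p i) \<in> {0..1} \<and>
          (if fst (p i) = snd (p i) then p (Suc i) = p i else snd (p i) \<noteq> 1 \<and> p (Suc i) \<noteq> (1, 1))"
        using P[of n] unfolding fabric_def by simp
    qed
    moreover have "(\<lambda>n. fdist (\<sigma> n) p) \<longlonglongrightarrow> 0"
    proof (rule LIMSEQ_I)
      fix r :: real assume "0 < r"
      then obtain k where k: "(1/2::real) ^ k < r" using real_arch_pow_inv[of r "1/2"] by auto
      have "norm (fdist (\<sigma> n) p - 0) < r" if n: "n \<ge> (\<Sum>i<k. N i)" for n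
      proof -
        have "\<sigma> n i = p i" if "i < k" for i
        proof -
          have "N i \<le> (\<Sum>i<k. N i)" using that by (intro member_le_sum) auto
          then show ?thesis using N[of i n] n by (simp add: p_def)
        qed
        then have "fdist (\<sigma> n) p \<le> (1/2) ^ k" using fdist_agree[OF P \<open>p \<in> fabric\<close>] by blast
        then show ?thesis using k fab.d_props(2)[OF P \<open>p \<in> fabric\<close>] by simp
      qed
      then show "\<exists>no. \<forall>n\<ge>no. norm (fdist (\<sigma> n) p - 0) < r" by blast
    qed
    ultimately show ?thesis by blast
  qed
qed

section \<open>Connectedness of the self-similar block\<close>

text \<open>Connectedness is used in the form that locally constant predicates are constant. It applies to
closed blocks at all depths by composition with \<open>embed\<close>, without subspaces.\<close>

definition locally_constant_on :: "'k set \<Rightarrow> ('k \<Rightarrow> 'k \<Rightarrow> real) \<Rightarrow> ('k \<Rightarrow> bool) \<Rightarrow> bool" where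
  "locally_constant_on K d \<psi> \<longleftrightarrow> (\<forall>p\<in>K. \<exists>e>0. \<forall>q\<in>K. d p q < e \<longrightarrow> \<psi> q = \<psi> p)"

lemma fab_embed_in: "fedge s t w \<Longrightarrow> k \<in> fabric \<Longrightarrow> fab.embed s t w k \<in> fabric"
  using fab.embed_in fabric_points by blast

lemma locally_constant_embed:
  assumes "locally_constant_on fabric fdist \<psi>" "fedge s t w"
  shows "locally_constant_on fabric fdist (\<lambda>k. \<psi> (fab.embed s t w k))"
  unfolding locally_constant_on_def
proof
  fix k assume k: "k \<in> fabric"
  then obtain e where e: "0 < e"
    "\<And>q. q \<in> fabric \<Longrightarrow> fdist (fab.embed s t w k) q < e \<Longrightarrow> \<psi> q = \<psi> (fab.embed s t w k)"
    using assms(1) fab_embed_in[OF assms(2)] unfolding locally_constant_on_def by metis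
  have "\<psi> (fab.embed s t w l) = \<psi> (fab.embed s t w k)" if "l \<in> fabric" "fdist k l < e" for l
    using e(2)[OF fab_embed_in[OF assms(2) that(1)]] fdist_embed[OF assms(2) k that(1)] that(2) e(1)
    by simp
  then show "\<exists>e>0. \<forall>l\<in>fabric. fdist k l < e \<longrightarrow> \<psi> (fab.embed s t w l) = \<psi> (fab.embed s t w k)"
    using e(1) by blast
qed

lemma fdist_vtx_embed_start:
  assumes "fedge s t w"
  shows "fdist (vtx s) (fab.embed s t w (vtx 0)) = w"
proof -
  have s: "s \<in> {0..1}" and w: "w = \<bar>t - s\<bar>" "0 \<le> w" using assms by (auto simp: fedge_def)
  have c: "fab.embed s t w (vtx 0) \<in> fabric" using fab_embed_in[OF assms] fab.ends by simp
  have "fab.near fdist (fab.embed s t w (vtx 0)) s = w"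
    using assms fab.ends w(2) by (simp add: fab.embed_def fab.near_mk fab.d_props(1))
  then have "fdist (fab.embed s t w (vtx 0)) (vtx s) = w"
    using fdist_vtx[OF c s] w by simp
  then show ?thesis using fab.d_props(4)[OF c vtx_in_fabric[OF s]] by simp
qed

text \<open>The first end of the block over \<open>(s, t)\<close> has distance \<open>|s - t|\<close> from the vertex \<open>s\<close>, and its second
end is the vertex \<open>t\<close>. So a predicate that is constant on blocks takes the same
value at \<open>s\<close> and at all \<open>t\<close> close to \<open>s\<close>, and the connectedness of the interval does the rest.\<close>

lemma constant_if_constant_on_blocks:
  assumes lc: "locally_constant_on fabric fdist \<psi>"
    and blocks: "\<And>s t w k l. fedge s t w \<Longrightarrow> k \<in> fabric \<Longrightarrow> l \<in> fabric \<Longrightarrow>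
      \<psi> (fab.embed s t w k) = \<psi> (fab.embed s t w l)"
    and pq: "p \<in> fabric" "q \<in> fabric"
  shows "\<psi> p = \<psi> q"
proof -
  have near: "\<exists>e>0. \<forall>t\<in>{0..1}. \<bar>t - s\<bar> < e \<longrightarrow> \<psi> (vtx t) = \<psi> (vtx s)" if s: "s \<in> {0..1}" for s
  proof -
    obtain e where e: "0 < e" "\<And>q. q \<in> fabric \<Longrightarrow> fdist (vtx s) q < e \<Longrightarrow> \<psi> q = \<psi> (vtx s)"
      using lc vtx_in_fabric[OF s] unfolding locally_constant_on_def by blast
    \<comment> \<open>As no edge leads to \<open>1\<close>, the radius keeps \<open>t\<close> away from \<open>1\<close> unless \<open>s = 1\<close>.\<close>
    define e' where "e' = (if s = 1 then e else min e (1 - s))"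
    have "\<psi> (vtx t) = \<psi> (vtx s)" if t: "t \<in> {0..1}" "\<bar>t - s\<bar> < e'" for t
    proof (cases "t = s")
      case False
      then have E: "fedge s t \<bar>s - t\<bar>" using s t by (auto simp: fedge_def e'_def split: if_splits)
      have "\<bar>s - t\<bar> < e" using t by (auto simp: e'_def split: if_splits)
      then have "\<psi> (fab.embed s t \<bar>s - t\<bar> (vtx 0)) = \<psi> (vtx s)"
        using e(2)[OF fab_embed_in[OF E]] fdist_vtx_embed_start[OF E] fab.ends by simp
      moreover have "fab.embed s t \<bar>s - t\<bar> (vtx 1) = vtx t" by (simp add: fab.embed_def)
      ultimately show ?thesis using blocks[OF E fab.ends(1,2)] by simp
    qed simp
    moreover have "0 < e'" using e(1) s by (auto simp: e'_def)
    ultimately show ?thesis by blast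
  qed
  have vertices: "\<psi> (vtx s) = \<psi> (vtx t)" if "s \<in> {0..1}" "t \<in> {0..1}" for s t
  proof (rule connected_equivalence_relation[of "{0..1::real}" s t "\<lambda>s t. \<psi> (vtx s) = \<psi> (vtx t)"])
    fix a :: real assume a: "a \<in> {0..1}"
    then obtain e where e: "0 < e" "\<forall>t\<in>{0..1}. \<bar>t - a\<bar> < e \<longrightarrow> \<psi> (vtx t) = \<psi> (vtx a)"
      using near by blast
    have "openin (top_of_set {0..1}) ({0..1} \<inter> ball a e)" by (simp add: openin_open_Int)
    moreover have "a \<in> {0..1} \<inter> ball a e" using a e(1) by simp
    moreover have "\<psi> (vtx a) = \<psi> (vtx x)" if "x \<in> {0..1} \<inter> ball a e" for x
    proof -
      have "\<bar>x - a\<bar> < e" using that by (simp add: dist_real_def abs_minus_commute)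
      then show ?thesis using e(2) that by blast
    qed
    ultimately show "\<exists>T. openin (top_of_set {0..1}) T \<and> a \<in> T \<and> (\<forall>x\<in>T. \<psi> (vtx a) = \<psi> (vtx x))"
      by blast
  qed (use that in auto)
  have "\<psi> r = \<psi> (vtx (ftgt r))" if "r \<in> fabric" for r
  proof -
    have "r \<in> fab.points" using that fabric_points by simp
    then show ?thesis
    proof (cases rule: fab.points_cases)
      case (edge s t w k)
      then show ?thesis
        using blocks[OF edge(1,2) fab.ends(2)] by (simp add: fab.embed_def)
    qed simp
  qed
  then show ?thesis using vertices ftgt_in pq by metis
qed

text \<open>A predicate that is not constant is not constant on some block; as the block is a copy of the whole,
this can be repeated. The edges found in this way form an infinite word, and the
predicate is constant near it.\<close>

lemma fabric_connected:
  assumes "locally_constant_on fabric fdist \<psi>" "p \<in> fabric" "q \<in> fabric"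
  shows "\<psi> p = \<psi> q"
proof (rule ccontr)
  assume ne: "\<psi> p \<noteq> \<psi> q"
  define P where "P = (\<lambda>n \<phi>. locally_constant_on fabric fdist \<phi> \<and>
      (\<exists>k\<in>fabric. \<exists>l\<in>fabric. \<phi> k \<noteq> \<phi> l) \<and> (n = (0::nat) \<longrightarrow> \<phi> = \<psi>))"
  define Q where "Q = (\<lambda>(n::nat) \<phi> \<phi>' :: word \<Rightarrow> bool.
      \<exists>s t. fedge s t \<bar>s - t\<bar> \<and> \<phi>' = (\<lambda>k. \<phi> (fab.embed s t \<bar>s - t\<bar> k)))"
  have "\<exists>f. \<forall>n. P n (f n) \<and> Q n (f n) (f (Suc n))"
  proof (rule dependent_nat_choice)
    show "\<exists>\<phi>. P 0 \<phi>" using assms ne by (auto simp: P_def)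
    fix \<phi> n assume "P n \<phi>"
    then have lc: "locally_constant_on fabric fdist \<phi>" and nc: "\<exists>k\<in>fabric. \<exists>l\<in>fabric. \<phi> k \<noteq> \<phi> l"
      by (auto simp: P_def)
    obtain s t w k l where E: "fedge s t w" and kl: "k \<in> fabric" "l \<in> fabric"
      and neq: "\<phi> (fab.embed s t w k) \<noteq> \<phi> (fab.embed s t w l)"
      using constant_if_constant_on_blocks[OF lc] nc by blast
    have w: "w = \<bar>s - t\<bar>" using E by (simp add: fedge_def)
    have "P (Suc n) (\<lambda>k. \<phi> (fab.embed s t w k))"
      using locally_constant_embed[OF lc E] kl neq by (auto simp: P_def)
    moreover have "Q n \<phi> (\<lambda>k. \<phi> (fab.embed s t w k))"
      using E w by (auto simp: Q_def)
    ultimately show "\<exists>\<phi>'. P (Suc n) \<phi>' \<and> Q n \<phi> \<phi>'" by blast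
  qed
  then obtain f where P: "\<And>n. P n (f n)" and Q: "\<And>n. Q n (f n) (f (Suc n))" by blast
  have f0: "f 0 = \<psi>" using P[of 0] by (simp add: P_def)
  from Q have "\<forall>n. \<exists>s t. fedge s t \<bar>s - t\<bar> \<and> f (Suc n) = (\<lambda>k. f n (fab.embed s t \<bar>s - t\<bar> k))"
    by (simp add: Q_def)
  then obtain s t where E: "\<And>n. fedge (s n) (t n) \<bar>s n - t n\<bar>"
    and fS: "\<And>n. f (Suc n) = (\<lambda>k. f n (fab.embed (s n) (t n) \<bar>s n - t n\<bar> k))"
    by metis
  \<comment> \<open>\<open>tail n\<close> is the limit word without its first \<open>n\<close> edges.\<close>
  define tail where "tail = (\<lambda>n i. (s (n + i), t (n + i)))"
  have tail_in: "tail n \<in> fabric" for n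
    using E by (auto simp: fabric_def tail_def fedge_def)
  have tail_embed: "fab.embed (s n) (t n) \<bar>s n - t n\<bar> (tail (Suc n)) = tail n" for n
  proof -
    have "tail (Suc n) 0 \<noteq> (1, 1)" using E[of "Suc n"] by (auto simp: tail_def fedge_def)
    then have "tail (Suc n) \<noteq> vtx 1" by (auto simp: vtx_def fun_eq_iff)
    then show ?thesis
      by (auto simp: fab.embed_def prefix_def tail_def fun_eq_iff split: nat.split)
  qed
  \<comment> \<open>The \<open>n\<close>-th predicate looks at \<open>\<psi>\<close> through the \<open>n\<close>-fold nested block, which has shrunk by \<open>(1/2) ^ n\<close>.\<close>
  have track: "\<exists>k'\<in>fabric. f n k = \<psi> k' \<and> fdist (tail 0) k' = (1/2) ^ n * fdist (tail n) k"
    if "k \<in> fabric" for n k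
    using that
  proof (induction n arbitrary: k)
    case 0
    then show ?case using f0 by auto
  next
    case (Suc n)
    define c where "c = fab.embed (s n) (t n) \<bar>s n - t n\<bar> k"
    have "c \<in> fabric" using fab_embed_in[OF E Suc.prems] by (simp add: c_def)
    then obtain k' where k': "k' \<in> fabric" "f n c = \<psi> k'" "fdist (tail 0) k' = (1/2) ^ n * fdist (tail n) c"
      using Suc.IH by blast
    have "fdist (tail n) c = fdist (tail (Suc n)) k / 2"
      using fdist_embed[OF E tail_in[of "Suc n"] Suc.prems, of n] tail_embed[of n] by (simp add: c_def)
    then show ?case using k' fS[of n] by (intro bexI[of _ k']) (auto simp: c_def)
  qed
  obtain e where e: "0 < e" "\<And>k. k \<in> fabric \<Longrightarrow> fdist (tail 0) k < e \<Longrightarrow> \<psi> k = \<psi> (tail 0)"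
    using assms(1) tail_in[of 0] unfolding locally_constant_on_def by blast
  obtain n where n: "(1/2::real) ^ n < e" using real_arch_pow_inv[of e "1/2"] e(1) by auto
  have "f n k = \<psi> (tail 0)" if k: "k \<in> fabric" for k
  proof -
    obtain k' where k': "k' \<in> fabric" "f n k = \<psi> k'" "fdist (tail 0) k' = (1/2) ^ n * fdist (tail n) k"
      using track[OF k] by blast
    have "fdist (tail n) k \<le> 1" using fab.d_props(3) tail_in k by blast
    then have "fdist (tail 0) k' \<le> (1/2) ^ n" using k'(3) by (simp add: mult_left_le)
    then show ?thesis using e(2)[OF k'(1)] k'(2) n by simp
  qed
  then show False using P[of n] by (auto simp: P_def)
qed

section \<open>Economical metrics from persistent labels\<close>

text \<open>All the distances that can be formed from a set of labels. Closure under maxima and halving is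
what the recursion for the metric asks for.\<close>

definition gaps :: "real set \<Rightarrow> real set" where
  "gaps S = {(1/2) ^ (j::nat) * \<bar>u - v\<bar> | j u v. u \<in> insert 0 (insert 1 S) \<and> v \<in> insert 0 (insert 1 S)}"

lemma gapsI: "u \<in> insert 0 (insert 1 S) \<Longrightarrow> v \<in> insert 0 (insert 1 S) \<Longrightarrow> (1/2) ^ (j::nat) * \<bar>u - v\<bar> \<in> gaps S"
  unfolding gaps_def by blast

lemma gaps_mono: "S \<subseteq> T \<Longrightarrow> gaps S \<subseteq> gaps T"
  unfolding gaps_def by blast

lemma gaps_abs: "u \<in> insert 0 (insert 1 S) \<Longrightarrow> v \<in> insert 0 (insert 1 S) \<Longrightarrow> \<bar>u - v\<bar> \<in> gaps S"
  using gapsI[of u S v 0] by simp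

lemma gaps_half:
  assumes "x \<in> gaps S"
  shows "x / 2 \<in> gaps S"
proof -
  obtain j :: nat and u v where x: "x = (1/2) ^ j * \<bar>u - v\<bar>"
    and uv: "u \<in> insert 0 (insert 1 S)" "v \<in> insert 0 (insert 1 S)"
    using assms unfolding gaps_def by blast
  have "x / 2 = (1/2) ^ Suc j * \<bar>u - v\<bar>" using x by simp
  then show ?thesis using gapsI[OF uv] by metis
qed

lemma gaps_power [simp]: "(1/2) ^ (j::nat) \<in> gaps S"
  using gapsI[of 1 S 0 j] by simp

lemma gaps_0_1 [simp]: "0 \<in> gaps S" "1 \<in> gaps S"
  using gaps_abs[of 0 S 0] gaps_abs[of 1 S 0] by simp_all

lemma gaps_max: "x \<in> gaps S \<Longrightarrow> y \<in> gaps S \<Longrightarrow> max x y \<in> gaps S"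
  by (simp add: max_def)

lemma countable_ordLeq_infinite:
  assumes "countable S" "infinite D"
  shows "|S| \<le>o |D|"
proof -
  have "|S| \<le>o |UNIV :: nat set|" using assms(1) by (auto simp: countable_def card_of_ordLeq[symmetric])
  then show ?thesis using assms(2) infinite_iff_card_of_nat ordLeq_transitive by blast
qed

lemma gaps_card_le:
  assumes "infinite D" "|S| \<le>o |D|"
  shows "|gaps S| \<le>o |D|"
proof -
  define T where "T = insert 0 (insert 1 S)"
  have "|{0, 1::real}| \<le>o |D|" using assms(1) by (intro countable_ordLeq_infinite) auto
  then have "|{0, 1} \<union> S| \<le>o |D|"
    using assms by (intro card_of_Un_ordLeq_infinite_Field) (auto simp: Field_card_of card_of_card_order_on)
  then have T: "|T| \<le>o |D|" by (simp add: T_def)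
  have N: "|UNIV :: nat set| \<le>o |D|" using assms(1) infinite_iff_card_of_nat by blast
  have "gaps S \<subseteq> (\<lambda>(j, u, v). (1/2) ^ j * \<bar>u - v\<bar>) ` ((UNIV :: nat set) \<times> T \<times> T)"
  proof
    fix x assume "x \<in> gaps S"
    then obtain j :: nat and u v where "x = (1/2) ^ j * \<bar>u - v\<bar>" "u \<in> T" "v \<in> T"
      unfolding gaps_def T_def by blast
    then show "x \<in> (\<lambda>(j, u, v). (1/2) ^ j * \<bar>u - v\<bar>) ` ((UNIV :: nat set) \<times> T \<times> T)"
      by (intro image_eqI[of _ _ "(j, u, v)"] SigmaI UNIV_I) (simp_all only: prod.case)
  qed
  then have "|gaps S| \<le>o |(UNIV :: nat set) \<times> T \<times> T|"
    using card_of_mono1 card_of_image ordLeq_transitive by metis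
  also have "|(UNIV :: nat set) \<times> T \<times> T| \<le>o |D|"
    by (intro card_of_Sigma_ordLeq_infinite ballI assms(1) T N)
  finally show ?thesis .
qed

text \<open>By persistence every label of a point of \<open>A\<close> is a label of a point of any dense subset \<open>D\<close>.
So the labels of \<open>D\<close>, at most \<open>|D|\<close> many, generate all the distances in \<open>A\<close>.\<close>

lemma economical_if_labelled:
  fixes L :: "'p \<Rightarrow> real set"
  assumes M: "Metric_space M d"
    and L: "\<And>p. p \<in> M \<Longrightarrow> countable (L p)"
    and vals: "\<And>p q. p \<in> M \<Longrightarrow> q \<in> M \<Longrightarrow> d p q \<in> gaps (L p \<union> L q)"
    and persist: "\<And>p l. p \<in> M \<Longrightarrow> l \<in> L p \<Longrightarrow> \<exists>e>0. \<forall>q\<in>M. d p q < e \<longrightarrow> l \<in> L q"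
  shows "economical M d"
  unfolding economical_def
proof (intro allI impI, elim conjE)
  interpret Metric_space M d by (rule M)
  fix A assume A: "A \<subseteq> M" "infinite A"
  show "|{d a b |a b. a \<in> A \<and> b \<in> A}| \<le>o dens mtopology A"
  proof (subst ordLeq_dens_iff)
    show "A \<subseteq> topspace mtopology" using A(1) by simp
    show "\<forall>D\<in>dense_subsets mtopology A. |{d a b |a b. a \<in> A \<and> b \<in> A}| \<le>o |D|"
    proof
      fix D assume "D \<in> dense_subsets mtopology A"
      then have D: "D \<subseteq> A" "A \<subseteq> mtopology closure_of D" by (auto simp: dense_subsets_def)
      have "infinite D"
      proof
        assume "finite D"
        then have "closedin mtopology D"
          using D(1) A(1) closedin_Hausdorff_finite[OF Hausdorff_space_mtopology] by simp
        then have "A \<subseteq> D" using D(2) by (simp add: closure_of_closedin)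
        then show False using A(2) \<open>finite D\<close> finite_subset by blast
      qed
      have labels: "L a \<subseteq> (\<Union>p\<in>D. L p)" if a: "a \<in> A" for a
      proof
        fix l assume "l \<in> L a"
        then obtain e where e: "0 < e" "\<forall>q\<in>M. d a q < e \<longrightarrow> l \<in> L q"
          using persist a A(1) by blast
        have "\<exists>q\<in>D. q \<in> mball a e" using D(2) a e(1) by (auto simp: metric_closure_of)
        then show "l \<in> (\<Union>p\<in>D. L p)" using e(2) by auto
      qed
      have "d a b \<in> gaps (\<Union>p\<in>D. L p)" if "a \<in> A" "b \<in> A" for a b
        using vals[of a b] that A(1) gaps_mono[of "L a \<union> L b"] labels by blast
      then have "{d a b |a b. a \<in> A \<and> b \<in> A} \<subseteq> gaps (\<Union>p\<in>D. L p)" by blast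
      then have "|{d a b |a b. a \<in> A \<and> b \<in> A}| \<le>o |gaps (\<Union>p\<in>D. L p)|" by (rule card_of_mono1)
      also have "|gaps (\<Union>p\<in>D. L p)| \<le>o |D|"
      proof (rule gaps_card_le[OF \<open>infinite D\<close>], rule card_of_UNION_ordLeq_infinite[OF \<open>infinite D\<close>])
        show "|D| \<le>o |D|" by (simp add: card_of_mono1)
        show "\<forall>p\<in>D. |L p| \<le>o |D|"
          using L D(1) A(1) countable_ordLeq_infinite[OF _ \<open>infinite D\<close>] by blast
      qed
      finally show "|{d a b |a b. a \<in> A \<and> b \<in> A}| \<le>o |D|" .
    qed
  qed
qed

definition digits :: "word \<Rightarrow> real set" where
  "digits p = range (\<lambda>i. fst (p i)) \<union> range (\<lambda>i. snd (p i))"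

lemma digits_shift: "digits (shift p) \<subseteq> digits p"
  by (auto simp: digits_def shift_def)

lemma digits_ends: "fsrc p \<in> digits p" "ftgt p \<in> digits p"
  by (auto simp: digits_def fsrc_def ftgt_def)

text \<open>The recursion for the distance to an end may run through infinitely many digits. After \<open>n\<close> steps either
the maximum has been decided by digits already read, or the distance is at most
\<open>(1/2) ^ n\<close>. As the error is only in the small term of a maximum, nothing is added up, and a
positive distance is decided after finitely many steps.\<close>

lemma fdist_end_gaps_or_small:
  assumes "p \<in> fabric" "u \<in> {0, 1}"
  shows "fdist p (vtx u) \<in> gaps (digits p) \<or> fdist p (vtx u) \<le> (1/2) ^ n"
  using assms
proof (induction n arbitrary: p u)
  case 0
  then show ?case using fab.d_props(3) fab.ends by auto
next
  case (Suc n)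
  have IH: "fdist (shift p) (vtx v) \<in> gaps (digits p) \<or> fdist (shift p) (vtx v) \<le> (1/2) ^ n"
    if "v \<in> {0, 1}" for v
    using Suc.IH[OF shift_in_fabric[OF Suc.prems(1)] that] gaps_mono[OF digits_shift[of p]] by blast
  have wt: "fwt p \<in> gaps (digits p)" using digits_ends[of p] by (simp add: fwt_def gaps_abs)
  have "fab.near fdist p u \<in> gaps (digits p) \<or> fab.near fdist p u \<le> (1/2) ^ n"
    using IH[of 0] IH[of 1] wt unfolding fab.near_def by (auto simp: max_def)
  moreover have "\<bar>ftgt p - u\<bar> \<in> gaps (digits p)"
    using digits_ends Suc.prems(2) by (intro gaps_abs) auto
  ultimately have "max \<bar>ftgt p - u\<bar> (fab.near fdist p u / 2) \<in> gaps (digits p) \<or>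
      max \<bar>ftgt p - u\<bar> (fab.near fdist p u / 2) \<le> (1/2) ^ Suc n"
    using gaps_half by (auto simp: max_def)
  moreover have "u \<in> {0..1}" using Suc.prems(2) by auto
  ultimately show ?case using fdist_vtx[OF Suc.prems(1)] by simp
qed

lemma fdist_end_gaps:
  assumes "p \<in> fabric" "u \<in> {0, 1}"
  shows "fdist p (vtx u) \<in> gaps (digits p)"
proof (rule ccontr)
  assume "\<not> ?thesis"
  then have small: "fdist p (vtx u) \<le> (1/2) ^ n" and nz: "fdist p (vtx u) \<noteq> 0" for n
    using fdist_end_gaps_or_small[OF assms] gaps_0_1(1) by metis+
  moreover have "0 \<le> fdist p (vtx u)"
    using fab.d_props(2)[OF assms(1)] assms(2) fab.ends by auto
  ultimately obtain n where "(1/2::real) ^ n < fdist p (vtx u)"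
    using real_arch_pow_inv[of "fdist p (vtx u)" "1/2"] by auto
  then show False using small[of n] by simp
qed

lemma near_gaps:
  assumes "p \<in> fabric"
  shows "fab.near fdist p v \<in> gaps (digits p)"
proof -
  have "fwt p \<in> gaps (digits p)" using digits_ends[of p] by (simp add: fwt_def gaps_abs)
  moreover have "fdist (shift p) (vtx 0) \<in> gaps (digits p)" "fdist (shift p) (vtx 1) \<in> gaps (digits p)"
    using fdist_end_gaps[OF shift_in_fabric[OF assms]] gaps_mono[OF digits_shift[of p]] by blast+
  ultimately show ?thesis unfolding fab.near_def by (auto simp: max_def)
qed

lemma fdist_gaps:
  assumes "p \<in> fabric" "q \<in> fabric"
  shows "fdist p q \<in> gaps (digits p \<union> digits q)"
proof (cases "p = q")
  case True
  then show ?thesis using assms fab.d_props(1) by simp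
next
  case False
  then obtain k where "p k \<noteq> q k" by auto
  then show ?thesis
    using assms
  proof (induction k arbitrary: p q rule: less_induct)
    case (less k)
    show ?case
    proof (cases "p 0 = q 0")
      case True
      then obtain k' where k: "k = Suc k'" using less.prems(1) by (cases k) auto
      have "fdist (shift p) (shift q) \<in> gaps (digits (shift p) \<union> digits (shift q))"
        by (rule less.IH[of k']) (use less.prems k shift_in_fabric in \<open>auto simp: shift_def\<close>)
      then have "fdist (shift p) (shift q) \<in> gaps (digits p \<union> digits q)"
        using gaps_mono[OF Un_mono[OF digits_shift[of p] digits_shift[of q]]] by blast
      then show ?thesis using fdist_same[OF less.prems(2,3) True] gaps_half by metis
    next
      case False
      have P: "p \<in> fab.points" using less.prems by (simp add: fabric_points)
      have "\<not> fab.same p q" using False fab_same_iff by simp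
      then obtain v where "fab.glue fdist p q = max (fab.near fdist p v) (fab.near fdist q v)"
        using fab.glue_diff_attained[OF P, of q] by metis
      moreover have "fab.near fdist p v \<in> gaps (digits p \<union> digits q)"
        "fab.near fdist q v \<in> gaps (digits p \<union> digits q)"
        using near_gaps less.prems gaps_mono[of "digits p" "digits p \<union> digits q"]
          gaps_mono[of "digits q" "digits p \<union> digits q"] by blast+
      ultimately have "fab.glue fdist p q / 2 \<in> gaps (digits p \<union> digits q)"
        using gaps_max gaps_half by simp
      moreover have "\<bar>ftgt p - ftgt q\<bar> \<in> gaps (digits p \<union> digits q)"
        using digits_ends by (intro gaps_abs) auto
      ultimately show ?thesis using fdist_rec[OF less.prems(2,3)] gaps_max by simp
    qed
  qed
qed

lemma fab_edge_block_open:
  assumes "p \<in> fabric" "fst (p 0) \<noteq> snd (p 0)"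
  obtains r where "0 < r" "\<And>q. q \<in> fabric \<Longrightarrow> fdist p q < r \<Longrightarrow> q 0 = p 0"
proof -
  have "p \<in> fab.points" "fsrc p \<noteq> ftgt p"
    using assms fabric_points by (auto simp: fsrc_def ftgt_def)
  then obtain r where r: "0 < r" "\<And>q. q \<in> fab.points \<Longrightarrow> fab.glue fdist p q < r \<Longrightarrow> fab.same p q"
    using fab.edge_block_open[OF fdist_end_zero] by metis
  show thesis
  proof (rule that[of "r / 2"])
    show "q 0 = p 0" if "q \<in> fabric" "fdist p q < r / 2" for q
      using r(2)[of q] fab_glue_le[OF assms(1) that(1)] that fabric_points fab_same_iff by auto
  qed (use r(1) in simp)
qed

text \<open>Blocks that come close to a vertex start or end at it and mention it in their first digit.\<close>

lemma vertex_digit_persists: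
  assumes "t \<in> {0..1}" "q \<in> fabric" "fdist (vtx t) q < 1/2"
  shows "t \<in> digits q"
proof -
  have q: "q \<in> fab.points" and t: "vtx t \<in> fabric" using assms fabric_points vtx_in_fabric by auto
  have "fab.glue fdist q (vtx t) < 1"
    using fab_glue_le[OF assms(2) t] fab.d_props(4)[OF assms(2) t] assms(3) by linarith
  then have "fab.near fdist q t < 1" using fab.glue_vx[OF q assms(1)] by simp
  then show ?thesis using fab.near_less1 digits_ends by metis
qed

lemma digits_persist:
  assumes "p \<in> fabric" "l \<in> digits p"
  shows "\<exists>e>0. \<forall>q\<in>fabric. fdist p q < e \<longrightarrow> l \<in> digits q"
proof -
  obtain k where "l \<in> {fst (p k), snd (p k)}" using assms(2) by (auto simp: digits_def)
  then show ?thesis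
    using assms(1)
  proof (induction k arbitrary: p rule: less_induct)
    case (less k)
    show ?case
    proof (cases "fst (p 0) = snd (p 0)")
      case True
      define t where "t = snd (p 0)"
      have p: "p = vtx t" unfolding t_def by (rule fabric_vertex[OF less.prems(2) True])
      have l: "l = t" using less.prems(1) unfolding p by (simp add: vtx_def)
      have "t \<in> {0..1}" using ftgt_in[OF less.prems(2)] by (simp add: ftgt_def t_def)
      then have "\<forall>q\<in>fabric. fdist p q < 1/2 \<longrightarrow> l \<in> digits q"
        unfolding p l using vertex_digit_persists by blast
      then show ?thesis by (intro exI[of _ "1/2"]) simp
    next
      case False
      obtain r where r: "0 < r" "\<And>q. q \<in> fabric \<Longrightarrow> fdist p q < r \<Longrightarrow> q 0 = p 0"
        using fab_edge_block_open[OF less.prems(2) False] by blast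
      show ?thesis
      proof (cases k)
        case 0
        then have "l \<in> digits q" if "q \<in> fabric" "fdist p q < r" for q
          using less.prems(1) r(2)[OF that] by (auto simp: digits_def intro: range_eqI[of _ _ 0])
        then show ?thesis using r(1) by blast
      next
        case (Suc k')
        have "l \<in> {fst (shift p k'), snd (shift p k')}" using less.prems(1) Suc by (simp add: shift_def)
        then obtain e where e: "0 < e"
          "\<And>q. q \<in> fabric \<Longrightarrow> fdist (shift p) q < e \<Longrightarrow> l \<in> digits q"
          using less.IH[of k' "shift p"] Suc shift_in_fabric[OF less.prems(2)] by blast
        have "l \<in> digits q" if q: "q \<in> fabric" "fdist p q < min r (e / 2)" for q
        proof -
          have "p 0 = q 0" using r(2) q by simp
          then have "fdist (shift p) (shift q) < e"
            using fdist_same[OF less.prems(2) q(1)] q(2) by simp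
          then show ?thesis using e(2) shift_in_fabric[OF q(1)] digits_shift by blast
        qed
        then show ?thesis using r(1) e(1) by (intro exI[of _ "min r (e / 2)"]) auto
      qed
    qed
  qed
qed

section \<open>The web over a weakly first countable space\<close>

text \<open>The type of points offers one real number per index, so the digits of the word occupy two
indices each; the first two indices store the edge and its weight.\<close>

definition cmk :: "'a \<Rightarrow> 'a \<Rightarrow> real \<Rightarrow> word \<Rightarrow> 'a pt" where
  "cmk x y w k = (\<lambda>n. if n = 0 then (x, w) else if n = 1 then (y, 0)
     else (x, (if even n then fst else snd) (k (n div 2 - 1))))"
text \<open>The weight \<open>0\<close> and the body \<open>vtx 1\<close> are default values, chosen to give every vertex a single code.\<close>

definition cvx :: "'a \<Rightarrow> 'a pt" where "cvx y = cmk y y 0 (vtx 1)"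
definition csrc :: "'a pt \<Rightarrow> 'a" where "csrc z = fst (z 0)"
definition ctgt :: "'a pt \<Rightarrow> 'a" where "ctgt z = fst (z 1)"
definition cwt :: "'a pt \<Rightarrow> real" where "cwt z = snd (z 0)"
definition cbody :: "'a pt \<Rightarrow> word" where
  "cbody z = (\<lambda>i. (snd (z (2 * i + 2)), snd (z (2 * i + 3))))"

lemma cmk_sel [simp]:
  "csrc (cmk x y w k) = x" "ctgt (cmk x y w k) = y" "cwt (cmk x y w k) = w" "cbody (cmk x y w k) = k"
  by (auto simp: csrc_def ctgt_def cwt_def cbody_def cmk_def fun_eq_iff)

locale weak_base =
  fixes X :: "'a topology" and B :: "'a \<Rightarrow> nat \<Rightarrow> 'a set"
  assumes B_dec: "x \<in> topspace X \<Longrightarrow> decseq (B x)"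
    and B_mem: "x \<in> topspace X \<Longrightarrow> x \<in> B x n"
    and B_sub: "x \<in> topspace X \<Longrightarrow> B x n \<subseteq> topspace X"
    and B_open: "U \<subseteq> topspace X \<Longrightarrow> openin X U \<longleftrightarrow> (\<forall>x\<in>U. \<exists>n. B x n \<subseteq> U)"
begin

definition cedge :: "'a \<Rightarrow> 'a \<Rightarrow> real \<Rightarrow> bool" where
  "cedge x y w \<longleftrightarrow> x \<in> topspace X \<and> y \<noteq> x \<and> (\<exists>n. w = (1/2) ^ n \<and> y \<in> B x n)"

sublocale cob: web_pmetric "topspace X" cedge fabric "vtx 0" "vtx 1" cvx cmk csrc ctgt cwt cbody fdist
proof unfold_locales
  show "s \<in> topspace X \<and> t \<in> topspace X \<and> s \<noteq> t \<and> 0 < w \<and> w \<le> 1" if "cedge s t w" for s t w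
    using that B_sub by (auto simp: cedge_def power_le_one)
qed (use fab.ends fdist_unit_pmetric fab.ends_dist in \<open>auto simp: cvx_def\<close>)

definition cdist :: "'a pt \<Rightarrow> 'a pt \<Rightarrow> real" where
  "cdist p q = (if p \<in> cob.points \<and> q \<in> cob.points then cob.glue fdist p q else 0)"

lemma cdist_eq: "p \<in> cob.points \<Longrightarrow> q \<in> cob.points \<Longrightarrow> cdist p q = cob.glue fdist p q"
  by (simp add: cdist_def)

sublocale Z: Metric_space cob.points cdist
proof
  show "0 \<le> cdist x y" for x y by (simp add: cdist_def cob.glue_ge0)
  show "cdist x y = cdist y x" for x y by (auto simp: cdist_def cob.glue_sym)
  show "cdist x y = 0 \<longleftrightarrow> x = y" if "x \<in> cob.points" "y \<in> cob.points" for x y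
  proof
    assume "cdist x y = 0"
    then have "cob.glue fdist x y = 0" using cdist_eq[OF that] by simp
    then show "x = y" using cob.glue_zero[OF _ that] fdist_zero by blast
  qed (use cdist_eq[OF that] cob.glue_refl[OF that(1)] in simp)
  show "cdist x z \<le> cdist x y + cdist y z"
    if "x \<in> cob.points" "y \<in> cob.points" "z \<in> cob.points" for x y z
    using cob.glue_triangle that by (simp add: cdist_eq)
qed

lemma cob_complete: "Z.mcomplete"
  unfolding Z.mcomplete_def
proof (intro allI impI)
  fix \<sigma> assume "Z.MCauchy \<sigma>"
  then have P: "\<And>n. \<sigma> n \<in> cob.points"
    and C: "\<And>e. 0 < e \<Longrightarrow> \<exists>N. \<forall>m\<ge>N. \<forall>n\<ge>N. cdist (\<sigma> m) (\<sigma> n) < e"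
    unfolding Z.MCauchy_def by (blast, metis)
  have "is_Cauchy (cob.glue fdist) \<sigma>"
    unfolding is_Cauchy_def using C by (simp add: cdist_eq P)
  then obtain x where x: "x \<in> cob.points" "(\<lambda>n. cob.glue fdist (\<sigma> n) x) \<longlonglongrightarrow> 0"
    using cob.complete_glue[OF fabric_complete] P unfolding complete_on_def by metis
  have "\<forall>\<^sub>F n in sequentially. \<sigma> n \<in> cob.points \<and> cdist (\<sigma> n) x < e" if "0 < e" for e
    using order_tendstoD(2)[OF x(2) that] P x(1) by (simp add: cdist_eq)
  then show "\<exists>x. limitin Z.mtopology \<sigma> x sequentially"
    using x(1) unfolding Z.limitin_metric by blast
qed

text \<open>The weights of the edges are powers of \<open>1/2\<close> and lie in \<open>gaps S\<close> for every \<open>S\<close>, so vertices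
and edges of the web need no labels of their own.\<close>

definition clabel :: "'a pt \<Rightarrow> real set" where
  "clabel z = (if csrc z = ctgt z then {} else digits (cbody z))"

lemma cob_block_open:
  assumes "z \<in> cob.points" "csrc z \<noteq> ctgt z"
  obtains r where "0 < r" "\<And>q. q \<in> cob.points \<Longrightarrow> cdist z q < r \<Longrightarrow> cob.same z q"
  using cob.edge_block_open[OF fdist_end_zero assms] cdist_eq[OF assms(1)] by metis

lemma cob_near_gaps:
  assumes z: "z \<in> cob.points"
  shows "cob.near fdist z v \<in> gaps (clabel z)"
  using z
proof (cases rule: cob.points_cases)
  case (edge s t w k)
  have "clabel z = digits k" using cob.edgeD[OF edge(1)] edge(4) by (simp add: clabel_def)
  moreover obtain n where "w = (1/2) ^ n" using edge(1) by (auto simp: cedge_def)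
  ultimately show ?thesis
    using edge fdist_end_gaps[OF edge(2)] by (auto simp: cob.near_mk intro!: gaps_max)
qed simp

lemma cob_economical: "economical cob.points cdist"
proof (rule economical_if_labelled[OF Z.Metric_space_axioms])
  show "countable (clabel p)" for p by (simp add: clabel_def digits_def)
  show "cdist p q \<in> gaps (clabel p \<union> clabel q)" if pq: "p \<in> cob.points" "q \<in> cob.points" for p q
  proof (cases "cob.same p q")
    case False
    obtain v where v: "cob.glue fdist p q = max (cob.near fdist p v) (cob.near fdist q v)"
      using cob.glue_diff_attained[OF pq(1) False] by blast
    show ?thesis
      unfolding cdist_eq[OF pq] v
      using gaps_max cob_near_gaps pq gaps_mono[of "clabel p" "clabel p \<union> clabel q"]
          gaps_mono[of "clabel q" "clabel p \<union> clabel q"] by blast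
  next
    case True
    show ?thesis
    proof (cases "csrc p = ctgt p")
      case True
      then have "p = q" using cob.same_eqI[OF pq \<open>cob.same p q\<close>] by simp
      then show ?thesis using pq by simp
    next
      case False
      then have "clabel p = digits (cbody p)" "clabel q = digits (cbody q)"
        using True by (auto simp: clabel_def cob.same_def)
      then show ?thesis
        using True fdist_gaps[OF cob.body_in cob.body_in, OF pq] by (simp add: cdist_eq pq cob.glue_def)
    qed
  qed
  show "\<exists>e>0. \<forall>q\<in>cob.points. cdist p q < e \<longrightarrow> l \<in> clabel q"
    if p: "p \<in> cob.points" and l: "l \<in> clabel p" for p l
  proof -
    have e: "csrc p \<noteq> ctgt p" and l': "l \<in> digits (cbody p)" using l by (auto simp: clabel_def split: if_splits)
    obtain r where r: "0 < r" "\<And>q. q \<in> cob.points \<Longrightarrow> cdist p q < r \<Longrightarrow> cob.same p q"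
      using cob_block_open[OF p e] by blast
    obtain e where e': "0 < e" "\<And>k. k \<in> fabric \<Longrightarrow> fdist (cbody p) k < e \<Longrightarrow> l \<in> digits k"
      using digits_persist[OF cob.body_in[OF p] l'] by blast
    have "l \<in> clabel q" if q: "q \<in> cob.points" "cdist p q < min r e" for q
    proof -
      have s: "cob.same p q" using r(2) q by simp
      then have "fdist (cbody p) (cbody q) < e" using q by (simp add: cdist_eq[OF p] cob.glue_def)
      then have "l \<in> digits (cbody q)" using e'(2) cob.body_in q(1) by blast
      then show ?thesis using e s by (auto simp: clabel_def cob.same_def)
    qed
    then show ?thesis using r(1) e'(1) by (intro exI[of _ "min r e"]) auto
  qed
qed

lemma cob_complete_economical: "complete_economical_metric_space cob.points cdist"
  unfolding complete_economical_metric_space_def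
  using Z.Metric_space_axioms cob_complete cob_economical by blast

lemma cob_image: "ctgt ` cob.points = topspace X"
  using cob.tgt_in cob.vx_in cob.tgt_vx by (auto intro!: image_eqI[of _ ctgt "cvx _"])

text \<open>At a vertex \<open>y\<close>, a ball of radius \<open>(1/2) ^ n \<le> 1\<close> meets only blocks hanging on \<open>y\<close> and blocks that
start at \<open>y\<close> with a jump shorter than \<open>(1/2) ^ n\<close>. The latter hang on points of
\<open>B y n\<close>, as \<open>B y\<close> decreases.\<close>

lemma cob_preimage_open:
  assumes U: "openin X U"
  shows "openin Z.mtopology {z \<in> cob.points. ctgt z \<in> U}"
  unfolding Z.openin_mtopology
proof (intro conjI allI impI)
  fix z assume "z \<in> {z \<in> cob.points. ctgt z \<in> U}"
  then have z: "z \<in> cob.points" "ctgt z \<in> U" by auto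
  have "\<exists>r>0. \<forall>q\<in>cob.points. cdist z q < r \<longrightarrow> ctgt q \<in> U"
  proof (cases "csrc z = ctgt z")
    case False
    then obtain r where "0 < r" "\<And>q. q \<in> cob.points \<Longrightarrow> cdist z q < r \<Longrightarrow> cob.same z q"
      using cob_block_open[OF z(1)] by blast
    then show ?thesis using z(2) by (auto simp: cob.same_def)
  next
    case True
    define y where "y = ctgt z"
    have zy: "z = cvx y" using cob.vertex_eq[OF z(1) True] by (simp only: y_def)
    have y: "y \<in> topspace X" "y \<in> U" using z cob.tgt_in by (auto simp: y_def)
    obtain n where n: "B y n \<subseteq> U" using B_open[of U] U y openin_subset by blast
    have "ctgt q \<in> U" if q: "q \<in> cob.points" "cdist z q < (1/2) ^ n" for q
    proof -
      have "cob.near fdist q y = cdist z q"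
        using cob.glue_vx[OF q(1) y(1)] cob.glue_sym[OF q(1) z(1)] cdist_eq[OF z(1) q(1)] zy by simp
      then have near: "cob.near fdist q y < (1/2) ^ n" using q(2) by simp
      have le1: "(1/2::real) ^ n \<le> 1" by (simp add: power_le_one)
      from q(1) show ?thesis
      proof (cases rule: cob.points_cases)
        case (vertex v)
        then show ?thesis using near y(2) le1 by (auto split: if_splits)
      next
        case (edge s t w k)
        show ?thesis
        proof (cases "t = y")
          case False
          have "s = y" "w < (1/2) ^ n"
            using near edge False le1 by (auto simp: cob.near_mk split: if_splits)
          then obtain m where m: "(1/2::real) ^ m < (1/2) ^ n" "t \<in> B y m"
            using edge(1) by (auto simp: cedge_def)
          have "n \<le> m"
          proof (rule ccontr)
            assume "\<not> n \<le> m"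
            then have "(1/2::real) ^ n \<le> (1/2) ^ m" by (intro power_decreasing) auto
            then show False using m(1) by simp
          qed
          then show ?thesis using B_dec[OF y(1)] m(2) n edge(4) by (auto simp: decseq_def)
        qed (use y edge in simp)
      qed
    qed
    then show ?thesis by (intro exI[of _ "(1/2) ^ n"]) auto
  qed
  then show "\<exists>r>0. Z.mball z r \<subseteq> {z \<in> cob.points. ctgt z \<in> U}" by (auto simp: subset_iff)
qed auto

lemma cob_continuous: "continuous_map Z.mtopology X ctgt"
  unfolding continuous_map_def using cob_preimage_open cob_image by auto

text \<open>The first end of the block over the edge from \<open>y\<close> to \<open>t \<in> B y n\<close> of weight \<open>(1/2) ^ n\<close> is mapped
to \<open>t\<close> and has distance \<open>(1/2) ^ n\<close> from the vertex \<open>y\<close>.\<close>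

lemma cob_image_contains_weak_nbhd:
  assumes W: "openin Z.mtopology W" and y: "y \<in> topspace X" "cvx y \<in> W"
  obtains n where "B y n \<subseteq> ctgt ` W"
proof -
  obtain r where r: "0 < r" "Z.mball (cvx y) r \<subseteq> W" using W y Z.openin_mtopology by blast
  obtain n where n: "(1/2::real) ^ n < r" using real_arch_pow_inv[of r "1/2"] r(1) by auto
  have "t \<in> ctgt ` W" if t: "t \<in> B y n" for t
  proof (cases "t = y")
    case True
    then show ?thesis using y by (intro image_eqI[of _ _ "cvx y"]) auto
  next
    case False
    then have E: "cedge y t ((1/2) ^ n)" using y t by (auto simp: cedge_def)
    define q where "q = cmk y t ((1/2) ^ n) (vtx 0)"
    have q: "q \<in> cob.points" unfolding q_def using cob.mk_in[OF E] fab.ends by simp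
    have "cdist (cvx y) q = cob.near fdist q y"
      using cob.glue_vx[OF q y(1)] cob.glue_sym[OF q cob.vx_in[OF y(1)]] cdist_eq q y(1) by simp
    also have "\<dots> = (1/2) ^ n"
      using fab.ends by (simp add: q_def cob.near_mk[OF E] fab.d_props(1))
    finally have "q \<in> W" using n r(2) q y(1) by auto
    then show ?thesis by (intro image_eqI[of _ _ q]) (auto simp: q_def)
  qed
  then show thesis using that by blast
qed

lemma cob_quotient: "quotient_map Z.mtopology X ctgt"
  unfolding quotient_map_def
proof (intro conjI allI impI)
  show "ctgt ` topspace Z.mtopology = topspace X" using cob_image by simp
  fix U assume U: "U \<subseteq> topspace X"
  show "openin Z.mtopology {x \<in> topspace Z.mtopology. ctgt x \<in> U} = openin X U"
  proof
    assume W: "openin Z.mtopology {x \<in> topspace Z.mtopology. ctgt x \<in> U}"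
    have "\<exists>n. B y n \<subseteq> U" if y: "y \<in> U" for y
    proof -
      have "y \<in> topspace X" "cvx y \<in> {x \<in> topspace Z.mtopology. ctgt x \<in> U}" using y U by auto
      from cob_image_contains_weak_nbhd[OF W this] obtain n
        where "B y n \<subseteq> ctgt ` {x \<in> topspace Z.mtopology. ctgt x \<in> U}" .
      then show ?thesis by blast
    qed
    then show "openin X U" using B_open[OF U] by blast
  qed (use cob_preimage_open in simp)
qed

lemma cob_hereditarily_quotient:
  assumes "\<And>y n. y \<in> topspace X \<Longrightarrow> openin X (B y n)"
  shows "hereditarily_quotient_map Z.mtopology X ctgt"
  unfolding hereditarily_quotient_map_def
proof (intro allI impI, elim conjE)
  fix U y assume U: "openin Z.mtopology U" and y: "y \<in> topspace X"
    and "{x \<in> topspace Z.mtopology. ctgt x = y} \<subseteq> U"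
  then have "cvx y \<in> U" by auto
  then obtain n where "B y n \<subseteq> ctgt ` U" using cob_image_contains_weak_nbhd[OF U y] by blast
  then show "y \<in> X interior_of (ctgt ` U)"
    unfolding interior_of_def using assms[OF y] B_mem[OF y] by blast
qed

text \<open>The fibre over \<open>y\<close> is the union of the closed blocks hanging on the vertex \<open>y\<close>, which all contain
this vertex; a separation of the fibre would induce a locally constant predicate on each block.\<close>

lemma cob_monotone: "monotone_map Z.mtopology X ctgt"
  unfolding monotone_map_def
proof (intro conjI ballI)
  show "ctgt ` topspace Z.mtopology \<subseteq> topspace X" using cob_image by simp
  fix y assume y: "y \<in> topspace X"
  define S where "S = {x \<in> topspace Z.mtopology. ctgt x = y}"
  have "\<not> (\<exists>E1 E2. openin Z.mtopology E1 \<and> openin Z.mtopology E2 \<and> S \<subseteq> E1 \<union> E2 \<and>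
      E1 \<inter> E2 \<inter> S = {} \<and> E1 \<inter> S \<noteq> {} \<and> E2 \<inter> S \<noteq> {})"
  proof (rule notI, elim exE conjE)
    fix E1 E2 assume O: "openin Z.mtopology E1" "openin Z.mtopology E2"
      and cov: "S \<subseteq> E1 \<union> E2" and dis: "E1 \<inter> E2 \<inter> S = {}" and ne: "E1 \<inter> S \<noteq> {}" "E2 \<inter> S \<noteq> {}"
    have "z \<in> E1 \<longleftrightarrow> cvx y \<in> E1" if "z \<in> S" for z
    proof -
      have z: "z \<in> cob.points" "ctgt z = y" using that by (auto simp: S_def)
      from z(1) show ?thesis
      proof (cases rule: cob.points_cases)
        case (edge s t w k)
        have t: "t = y" using edge z(2) by simp
        have in_S: "cob.embed s t w l \<in> S" if "l \<in> fabric" for l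
          using cob.embed_in[OF edge(1) that] t by (simp add: S_def)
        have "locally_constant_on fabric fdist (\<lambda>l. cob.embed s t w l \<in> E1)"
          unfolding locally_constant_on_def
        proof
          fix l assume l: "l \<in> fabric"
          define E where "E = (if cob.embed s t w l \<in> E1 then E1 else E2)"
          have "cob.embed s t w l \<in> E" "openin Z.mtopology E"
            using in_S[OF l] cov O by (auto simp: E_def)
          then obtain e where e: "0 < e" "Z.mball (cob.embed s t w l) e \<subseteq> E"
            unfolding Z.openin_mtopology by blast
          have "(cob.embed s t w m \<in> E1) = (cob.embed s t w l \<in> E1)" if m: "m \<in> fabric" "fdist l m < e" for m
          proof -
            have P: "cob.embed s t w l \<in> cob.points" "cob.embed s t w m \<in> cob.points"
              using cob.embed_in[OF edge(1)] l m(1) by auto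
            then have "cdist (cob.embed s t w l) (cob.embed s t w m) < e"
              using cob.glue_embed[OF edge(1) l m(1)] m(2) by (simp add: cdist_eq)
            then have "cob.embed s t w m \<in> E" using e(2) P by auto
            then show ?thesis using in_S[OF m(1)] dis by (auto simp: E_def split: if_splits)
          qed
          then show "\<exists>e>0. \<forall>m\<in>fabric. fdist l m < e \<longrightarrow>
              (cob.embed s t w m \<in> E1) = (cob.embed s t w l \<in> E1)"
            using e(1) by blast
        qed
        from fabric_connected[OF this edge(2) fab.ends(2)] show ?thesis
          using edge(3,4) t by (simp add: cob.embed_def)
      qed (use z(2) in auto)
    qed
    then show False using ne dis cov by blast
  qed
  then show "connectedin Z.mtopology {x \<in> topspace Z.mtopology. ctgt x = y}"
    unfolding connectedin S_def[symmetric] by (auto simp: S_def)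
qed

lemma cob_connected: "connected_space X \<Longrightarrow> connected_space Z.mtopology"
  using connected_space_monotone_quotient_map_preimage[OF cob_monotone cob_quotient] .

end

lemma first_countable_decreasing_base:
  assumes "first_countable X"
  obtains B where "weak_base X B" "\<And>x n. x \<in> topspace X \<Longrightarrow> openin X (B x n)"
proof -
  have "\<exists>V :: nat \<Rightarrow> 'a set. (\<forall>n. openin X (V n) \<and> x \<in> V n) \<and>
      (\<forall>U. openin X U \<and> x \<in> U \<longrightarrow> (\<exists>n. V n \<subseteq> U))" if x: "x \<in> topspace X" for x
  proof -
    obtain \<B> where \<B>: "countable \<B>" "\<And>V. V \<in> \<B> \<Longrightarrow> openin X V"
      "\<And>U. openin X U \<Longrightarrow> x \<in> U \<Longrightarrow> \<exists>V\<in>\<B>. x \<in> V \<and> V \<subseteq> U"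
      using assms x unfolding first_countable_def by metis
    define \<C> where "\<C> = {V \<in> \<B>. x \<in> V}"
    have "\<C> \<noteq> {}" using \<B>(3)[OF openin_topspace x] by (auto simp: \<C>_def)
    then have r: "range (from_nat_into \<C>) = \<C>"
      using \<B>(1) by (intro range_from_nat_into) (auto simp: \<C>_def)
    have "openin X (from_nat_into \<C> n) \<and> x \<in> from_nat_into \<C> n" for n
      using from_nat_into[OF \<open>\<C> \<noteq> {}\<close>, of n] \<B>(2) by (simp add: \<C>_def)
    moreover have "\<exists>n. from_nat_into \<C> n \<subseteq> U" if U: "openin X U" "x \<in> U" for U
    proof -
      obtain V where "V \<in> \<C>" "V \<subseteq> U" using \<B>(3)[OF U] by (auto simp: \<C>_def)
      then show ?thesis using r by (metis imageE)
    qed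
    ultimately show ?thesis by blast
  qed
  then obtain V :: "'a \<Rightarrow> nat \<Rightarrow> 'a set"
    where V: "\<And>x n. x \<in> topspace X \<Longrightarrow> openin X (V x n) \<and> x \<in> V x n"
      "\<And>x U. x \<in> topspace X \<Longrightarrow> openin X U \<Longrightarrow> x \<in> U \<Longrightarrow> \<exists>n. V x n \<subseteq> U"
    by metis
  \<comment> \<open>Finite intersections make the base decreasing.\<close>
  define B where "B = (\<lambda>x n. \<Inter>i\<le>n. V x i)"
  have op: "openin X (B x n)" if "x \<in> topspace X" for x n
    unfolding B_def using V(1)[OF that] by (intro openin_INT2) auto
  have mem: "x \<in> B x n" if "x \<in> topspace X" for x n
    using V(1)[OF that] by (simp add: B_def)
  have "weak_base X B"
  proof
    show "decseq (B x)" for x unfolding B_def decseq_def by (intro allI impI INT_anti_mono) auto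
    show "x \<in> B x n" if "x \<in> topspace X" for x n by (rule mem[OF that])
    show "B x n \<subseteq> topspace X" if "x \<in> topspace X" for x n using op[OF that] openin_subset by blast
    show "openin X U \<longleftrightarrow> (\<forall>x\<in>U. \<exists>n. B x n \<subseteq> U)" if U: "U \<subseteq> topspace X" for U
    proof
      assume O: "openin X U"
      show "\<forall>x\<in>U. \<exists>n. B x n \<subseteq> U"
      proof
        fix x assume x: "x \<in> U"
        then obtain n where "V x n \<subseteq> U" using V(2) O U by blast
        moreover have "B x n \<subseteq> V x n" by (auto simp: B_def)
        ultimately show "\<exists>n. B x n \<subseteq> U" by blast
      qed
    next
      assume *: "\<forall>x\<in>U. \<exists>n. B x n \<subseteq> U"
      have "\<exists>T. openin X T \<and> x \<in> T \<and> T \<subseteq> U" if x: "x \<in> U" for x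
      proof -
        have "x \<in> topspace X" using x U by blast
        moreover obtain n where "B x n \<subseteq> U" using * x by blast
        ultimately show ?thesis using op[of x n] mem[of x n] by (intro exI[of _ "B x n"]) simp
      qed
      then show "openin X U" by (intro iffD2[OF openin_subopen] ballI)
    qed
  qed
  then show thesis using that op by blast
qed

lemma weakly_first_countable_weak_base:
  assumes "weakly_first_countable X"
  obtains B where "weak_base X B"
proof -
  obtain B where B: "\<forall>x\<in>topspace X. decseq (B x) \<and> (\<forall>n. x \<in> B x n \<and> B x n \<subseteq> topspace X)"
    "\<forall>U. U \<subseteq> topspace X \<longrightarrow> (openin X U \<longleftrightarrow> (\<forall>x\<in>U. \<exists>n. B x n \<subseteq> U))"
    using assms unfolding weakly_first_countable_def by (elim exE conjE)
  have "weak_base X B" by unfold_locales (use B in simp_all)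
  then show thesis by (rule that)
qed

section \<open>The images of complete economical metric spaces\<close>

theorem theorem5p3:
  fixes X :: "'a topology"
  shows
    "(first_countable X \<longrightarrow>
        (\<exists>(Z :: 'a pt set) d f.
           complete_economical_metric_space Z d \<and>
           continuous_map (Metric_space.mtopology Z d) X f \<and> f ` Z = topspace X \<and>
           monotone_map (Metric_space.mtopology Z d) X f \<and>
           hereditarily_quotient_map (Metric_space.mtopology Z d) X f)) \<and>
     (first_countable X \<and> connected_space X \<longrightarrow>
        (\<exists>(Z :: 'a pt set) d f.
           complete_economical_metric_space Z d \<and>
           connected_space (Metric_space.mtopology Z d) \<and>
           continuous_map (Metric_space.mtopology Z d) X f \<and> f ` Z = topspace X \<and>
           monotone_map (Metric_space.mtopology Z d) X f \<and>
           hereditarily_quotient_map (Metric_space.mtopology Z d) X f)) \<and>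
     (weakly_first_countable X \<longrightarrow>
        (\<exists>(Z :: 'a pt set) d f.
           complete_economical_metric_space Z d \<and>
           continuous_map (Metric_space.mtopology Z d) X f \<and> f ` Z = topspace X \<and>
           monotone_map (Metric_space.mtopology Z d) X f \<and>
           quotient_map (Metric_space.mtopology Z d) X f)) \<and>
     (weakly_first_countable X \<and> connected_space X \<longrightarrow>
        (\<exists>(Z :: 'a pt set) d f.
           complete_economical_metric_space Z d \<and>
           connected_space (Metric_space.mtopology Z d) \<and>
           continuous_map (Metric_space.mtopology Z d) X f \<and> f ` Z = topspace X \<and>
           monotone_map (Metric_space.mtopology Z d) X f \<and>
           quotient_map (Metric_space.mtopology Z d) X f))"
proof (intro conjI impI; (elim conjE)?)
  {
    assume "first_countable X"
    then obtain B where B: "weak_base X B" "\<And>x n. x \<in> topspace X \<Longrightarrow> openin X (B x n)"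
      using first_countable_decreasing_base by blast
    interpret weak_base X B by (rule B(1))
    note facts = cob_complete_economical cob_continuous cob_image cob_monotone
      cob_hereditarily_quotient[OF B(2)]
    show "\<exists>(Z :: 'a pt set) d f. complete_economical_metric_space Z d \<and>
           continuous_map (Metric_space.mtopology Z d) X f \<and> f ` Z = topspace X \<and>
           monotone_map (Metric_space.mtopology Z d) X f \<and>
           hereditarily_quotient_map (Metric_space.mtopology Z d) X f"
      by (intro exI conjI) (rule facts; assumption?)+
    assume "connected_space X"
    show "\<exists>(Z :: 'a pt set) d f. complete_economical_metric_space Z d \<and>
           connected_space (Metric_space.mtopology Z d) \<and>
           continuous_map (Metric_space.mtopology Z d) X f \<and> f ` Z = topspace X \<and>
           monotone_map (Metric_space.mtopology Z d) X f \<and>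
           hereditarily_quotient_map (Metric_space.mtopology Z d) X f"
      by (intro exI conjI) (rule facts cob_connected[OF \<open>connected_space X\<close>]; assumption?)+
  }
  {
    assume "weakly_first_countable X"
    then obtain B where B: "weak_base X B" using weakly_first_countable_weak_base by blast
    interpret weak_base X B by (rule B)
    note facts = cob_complete_economical cob_continuous cob_image cob_monotone cob_quotient
    show "\<exists>(Z :: 'a pt set) d f. complete_economical_metric_space Z d \<and>
           continuous_map (Metric_space.mtopology Z d) X f \<and> f ` Z = topspace X \<and>
           monotone_map (Metric_space.mtopology Z d) X f \<and>
           quotient_map (Metric_space.mtopology Z d) X f"
      by (intro exI conjI) (rule facts)+
    assume "connected_space X"
    show "\<exists>(Z :: 'a pt set) d f. complete_economical_metric_space Z d \<and>
           connected_space (Metric_space.mtopology Z d) \<and>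
           continuous_map (Metric_space.mtopology Z d) X f \<and> f ` Z = topspace X \<and>
           monotone_map (Metric_space.mtopology Z d) X f \<and>
           quotient_map (Metric_space.mtopology Z d) X f"
      by (intro exI conjI) (rule facts cob_connected[OF \<open>connected_space X\<close>])+
  }
qed

end
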